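(* There is an isomorphism of groups $vP_3\cong\overline{P}_4*\mathbb{Z}$, where $*$ denotes the free product.
   Context: The pure virtual braid group $vP_3$ is the group with generators $x_{ij}$ ($1\le i\ne j\le3$) and relations $x_{ij}x_{ik}x_{jk}=x_{jk}x_{ik}x_{ij}$ for all distinct $i,j,k\in\{1,2,3\}$. $P_4$ is the Artin pure braid group on $4$ strings, and $\overline{P}_4=P_4/Z(P_4)$ is its quotient by its (infinite cyclic) center, so that $P_4\cong\overline{P}_4\times\mathbb{Z}$. *)

theory Defs
  imports "HOL-Algebra.Sym_Groups" "HOL-Algebra.Elementary_Groups"
begin

section \<open>Groups given by generators and relations\<close>

text \<open>A word is a list of letters; the letter \<open>(a, True)\<close> stands for the generator \<open>a\<close>
  and \<open>(a, False)\<close> for its formal inverse. A relation \<open>u = v\<close> is the pair \<open>(u, v)\<close>.\<close>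

type_synonym 'a word = "('a \<times> bool) list"

definition words :: "'a set \<Rightarrow> 'a word set" where
  "words S = lists (S \<times> UNIV)"

definition pos :: "'a list \<Rightarrow> 'a word" where
  "pos as = map (\<lambda>a. (a, True)) as"

inductive_set pres_cong :: "'a set \<Rightarrow> ('a word \<times> 'a word) set \<Rightarrow> ('a word \<times> 'a word) set"
  for S :: "'a set" and R :: "('a word \<times> 'a word) set" where
  refl: "w \<in> words S \<Longrightarrow> (w, w) \<in> pres_cong S R"
| sym: "(u, v) \<in> pres_cong S R \<Longrightarrow> (v, u) \<in> pres_cong S R"
| trans: "(u, v) \<in> pres_cong S R \<Longrightarrow> (v, w) \<in> pres_cong S R \<Longrightarrow> (u, w) \<in> pres_cong S R"
| cancel: "xs \<in> words S \<Longrightarrow> ys \<in> words S \<Longrightarrow> a \<in> S \<Longrightarrow>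
    (xs @ [(a, b), (a, \<not> b)] @ ys, xs @ ys) \<in> pres_cong S R"
| rel: "xs \<in> words S \<Longrightarrow> ys \<in> words S \<Longrightarrow> u \<in> words S \<Longrightarrow> v \<in> words S \<Longrightarrow> (u, v) \<in> R \<Longrightarrow>
    (xs @ u @ ys, xs @ v @ ys) \<in> pres_cong S R"

definition presented_group :: "'a set \<Rightarrow> ('a word \<times> 'a word) set \<Rightarrow> 'a word set monoid" where
  "presented_group S R =
    \<lparr> carrier = words S // pres_cong S R,
      mult = (\<lambda>A B. \<Union>u\<in>A. \<Union>v\<in>B. pres_cong S R `` {u @ v}),
      one = pres_cong S R `` {[]} \<rparr>"

fun word_eval :: "('b, 'c) monoid_scheme \<Rightarrow> ('a \<Rightarrow> 'b) \<Rightarrow> 'a word \<Rightarrow> 'b" where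
  "word_eval G f [] = \<one>\<^bsub>G\<^esub>"
| "word_eval G f ((a, b) # w) = (if b then f a else inv\<^bsub>G\<^esub> (f a)) \<otimes>\<^bsub>G\<^esub> word_eval G f w"

text \<open>The homomorphism out of a presented group extending \<open>f\<close> on the generators;
  meaningful only if \<open>f\<close> respects the relations.\<close>

definition pres_lift :: "('b, 'c) monoid_scheme \<Rightarrow> ('a \<Rightarrow> 'b) \<Rightarrow> 'a word set \<Rightarrow> 'b" where
  "pres_lift G f A = the_elem (word_eval G f ` A)"

lemma words_simps [simp]:
  "[] \<in> words S" "x # u \<in> words S \<longleftrightarrow> fst x \<in> S \<and> u \<in> words S"
  "u @ v \<in> words S \<longleftrightarrow> u \<in> words S \<and> v \<in> words S"
  by (auto simp: words_def mem_Times_iff)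

lemma pres_cong_words: "(u, v) \<in> pres_cong S R \<Longrightarrow> u \<in> words S \<and> v \<in> words S"
  by (induction rule: pres_cong.induct) auto

lemma equiv_pres_cong: "equiv (words S) (pres_cong S R)"
proof (rule equivI)
  show "pres_cong S R \<subseteq> words S \<times> words S" using pres_cong_words by fast
  show "refl_on (words S) (pres_cong S R)" by (intro refl_onI pres_cong.refl)
  show "sym (pres_cong S R)" by (intro symI) (rule pres_cong.sym)
  show "trans (pres_cong S R)" by (intro transI) (rule pres_cong.trans)
qed

lemma pres_cong_context:
  "(u, v) \<in> pres_cong S R \<Longrightarrow> p \<in> words S \<Longrightarrow> q \<in> words S \<Longrightarrow> (p @ u @ q, p @ v @ q) \<in> pres_cong S R"
proof (induction rule: pres_cong.induct)
  case (cancel xs ys a b)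
  then show ?case using pres_cong.cancel[of "p @ xs" S "ys @ q" a b R] by simp
next
  case (rel xs ys u v)
  then show ?case using pres_cong.rel[of "p @ xs" S "ys @ q" u v R] by simp
next
  case (sym u v)
  from sym.IH[OF sym.prems] show ?case by (rule pres_cong.sym)
next
  case (trans u v w)
  from trans.IH(1)[OF trans.prems] trans.IH(2)[OF trans.prems] show ?case by (rule pres_cong.trans)
qed (simp add: pres_cong.refl)

lemma pres_cong_append:
  assumes "(u, u') \<in> pres_cong S R" "(v, v') \<in> pres_cong S R"
  shows "(u @ v, u' @ v') \<in> pres_cong S R"
proof (rule pres_cong.trans)
  show "(u @ v, u' @ v) \<in> pres_cong S R"
    using pres_cong_context[OF assms(1), of "[]" v] assms[THEN pres_cong_words] by simp
  show "(u' @ v, u' @ v') \<in> pres_cong S R"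
    using pres_cong_context[OF assms(2), of u' "[]"] assms[THEN pres_cong_words] by simp
qed

lemma presented_group_mult:
  assumes "u \<in> words S" "v \<in> words S"
  shows "pres_cong S R `` {u} \<otimes>\<^bsub>presented_group S R\<^esub> pres_cong S R `` {v} = pres_cong S R `` {u @ v}"
proof -
  have "congruent2 (pres_cong S R) (pres_cong S R) (\<lambda>u v. pres_cong S R `` {u @ v})"
    by (rule congruent2I')
       (intro equiv_class_eq[OF equiv_pres_cong] pres_cong_append)
  from UN_equiv_class2[OF equiv_pres_cong equiv_pres_cong this assms] show ?thesis
    by (simp add: presented_group_def)
qed

lemma presented_group_carrierE:
  assumes "x \<in> carrier (presented_group S R)"
  obtains u where "u \<in> words S" "x = pres_cong S R `` {u}"
  using assms that quotientE[of x "words S" "pres_cong S R"]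
  unfolding presented_group_def by (metis partial_object.select_convs(1))

lemma presented_group_class_carrier:
  "u \<in> words S \<Longrightarrow> pres_cong S R `` {u} \<in> carrier (presented_group S R)"
  by (simp add: presented_group_def quotientI)

definition inv_word :: "'a word \<Rightarrow> 'a word" where
  "inv_word w = rev (map (\<lambda>(a, b). (a, \<not> b)) w)"

lemma inv_word_words: "w \<in> words S \<Longrightarrow> inv_word w \<in> words S"
  by (induction w) (auto simp: inv_word_def)

lemma inv_word_cancel: "w \<in> words S \<Longrightarrow> (inv_word w @ w, []) \<in> pres_cong S R"
proof (induction w)
  case Nil
  then show ?case by (simp add: inv_word_def pres_cong.refl)
next
  case (Cons x w)
  obtain a b where x: "x = (a, b)" by force
  have "(inv_word w @ [(a, \<not> b), (a, \<not> \<not> b)] @ w, inv_word w @ w) \<in> pres_cong S R"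
    using Cons.prems x by (intro pres_cong.cancel) (auto intro: inv_word_words)
  from pres_cong.trans[OF this] Cons x show ?case by (simp add: inv_word_def)
qed

lemma group_presented_group: "group (presented_group S R)"
proof (rule groupI)
  let ?G = "presented_group S R"
  have one: "\<one>\<^bsub>?G\<^esub> = pres_cong S R `` {[]}" by (simp add: presented_group_def)
  show "\<one>\<^bsub>?G\<^esub> \<in> carrier ?G" by (simp add: one presented_group_class_carrier)
  fix x assume "x \<in> carrier ?G"
  then obtain u where u: "u \<in> words S" "x = pres_cong S R `` {u}"
    by (rule presented_group_carrierE)
  show "\<one>\<^bsub>?G\<^esub> \<otimes>\<^bsub>?G\<^esub> x = x" using u by (simp add: one presented_group_mult)
  show "\<exists>y\<in>carrier ?G. y \<otimes>\<^bsub>?G\<^esub> x = \<one>\<^bsub>?G\<^esub>"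
  proof
    have "pres_cong S R `` {inv_word u @ u} = pres_cong S R `` {[]}"
      using inv_word_cancel[OF u(1)] by (rule equiv_class_eq[OF equiv_pres_cong])
    then show "pres_cong S R `` {inv_word u} \<otimes>\<^bsub>?G\<^esub> x = \<one>\<^bsub>?G\<^esub>"
      using u by (simp only: one presented_group_mult inv_word_words)
    show "pres_cong S R `` {inv_word u} \<in> carrier ?G"
      using u by (simp add: inv_word_words presented_group_class_carrier)
  qed
  fix y assume "y \<in> carrier ?G"
  then obtain v where v: "v \<in> words S" "y = pres_cong S R `` {v}"
    by (rule presented_group_carrierE)
  show "x \<otimes>\<^bsub>?G\<^esub> y \<in> carrier ?G"
    using u v by (simp add: presented_group_mult presented_group_class_carrier)
  fix z assume "z \<in> carrier ?G"
  then obtain w where w: "w \<in> words S" "z = pres_cong S R `` {w}"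
    by (rule presented_group_carrierE)
  show "x \<otimes>\<^bsub>?G\<^esub> y \<otimes>\<^bsub>?G\<^esub> z = x \<otimes>\<^bsub>?G\<^esub> (y \<otimes>\<^bsub>?G\<^esub> z)"
    using u v w by (simp add: presented_group_mult)
qed

lemma (in group) word_eval_closed:
  "f \<in> S \<rightarrow> carrier G \<Longrightarrow> w \<in> words S \<Longrightarrow> word_eval G f w \<in> carrier G"
  by (induction w) (auto simp: Pi_iff)

lemma (in group) word_eval_append:
  "f \<in> S \<rightarrow> carrier G \<Longrightarrow> u \<in> words S \<Longrightarrow> v \<in> words S \<Longrightarrow>
    word_eval G f (u @ v) = word_eval G f u \<otimes> word_eval G f v"
  by (induction u) (auto simp: Pi_iff m_assoc word_eval_closed[of f S])

lemma (in group) word_eval_cong: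
  assumes f: "f \<in> S \<rightarrow> carrier G"
    and R: "\<And>u v. (u, v) \<in> R \<Longrightarrow> u \<in> words S \<Longrightarrow> v \<in> words S \<Longrightarrow> word_eval G f u = word_eval G f v"
    and "(u, v) \<in> pres_cong S R"
  shows "word_eval G f u = word_eval G f v"
  using assms(3)
proof (induction rule: pres_cong.induct)
  case (cancel xs ys a b)
  have "f a \<in> carrier G" using f cancel by auto
  then have "word_eval G f ([(a, b), (a, \<not> b)] @ ys) = word_eval G f ys"
    using word_eval_closed[OF f cancel(2)] by (simp add: m_assoc[symmetric])
  moreover have "[(a, b), (a, \<not> b)] @ ys \<in> words S" using cancel by simp
  ultimately show ?case using cancel word_eval_append[OF f] by metis
next
  case (rel xs ys u v)
  then show ?case using R[of u v] by (simp add: word_eval_append[OF f])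
next
  case (trans u v w)
  then show ?case by simp
qed simp_all

lemma (in group) pres_lift_class:
  assumes f: "f \<in> S \<rightarrow> carrier G"
    and R: "\<And>u v. (u, v) \<in> R \<Longrightarrow> u \<in> words S \<Longrightarrow> v \<in> words S \<Longrightarrow> word_eval G f u = word_eval G f v"
    and w: "w \<in> words S"
  shows "pres_lift G f (pres_cong S R `` {w}) = word_eval G f w"
proof -
  have "word_eval G f ` (pres_cong S R `` {w}) = {word_eval G f w}"
  proof (intro equalityI subsetI)
    fix y assume "y \<in> word_eval G f ` (pres_cong S R `` {w})"
    then obtain v where "(w, v) \<in> pres_cong S R" "y = word_eval G f v" by blast
    moreover have "word_eval G f w = word_eval G f v"
      using f R \<open>(w, v) \<in> pres_cong S R\<close> by (rule word_eval_cong)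
    ultimately show "y \<in> {word_eval G f w}" by simp
  next
    fix y assume "y \<in> {word_eval G f w}"
    then show "y \<in> word_eval G f ` (pres_cong S R `` {w})"
      using pres_cong.refl[OF w, of R] by blast
  qed
  then show ?thesis by (simp add: pres_lift_def)
qed

lemma (in group) pres_lift_hom:
  assumes f: "f \<in> S \<rightarrow> carrier G"
    and R: "\<And>u v. (u, v) \<in> R \<Longrightarrow> u \<in> words S \<Longrightarrow> v \<in> words S \<Longrightarrow> word_eval G f u = word_eval G f v"
  shows "pres_lift G f \<in> hom (presented_group S R) G"
proof (rule homI)
  have L: "pres_lift G f (pres_cong S R `` {w}) = word_eval G f w" if "w \<in> words S" for w
    using f R that by (rule pres_lift_class)
  fix x assume "x \<in> carrier (presented_group S R)"
  then obtain u where u: "u \<in> words S" "x = pres_cong S R `` {u}"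
    by (rule presented_group_carrierE)
  show "pres_lift G f x \<in> carrier G"
    using L[OF u(1)] word_eval_closed[OF f u(1)] u(2) by simp
  fix y assume "y \<in> carrier (presented_group S R)"
  then obtain v where v: "v \<in> words S" "y = pres_cong S R `` {v}"
    by (rule presented_group_carrierE)
  show "pres_lift G f (x \<otimes>\<^bsub>presented_group S R\<^esub> y) = pres_lift G f x \<otimes> pres_lift G f y"
  proof -
    have "u @ v \<in> words S" using u v by simp
    from L[OF this] L[OF u(1)] L[OF v(1)] word_eval_append[OF f u(1) v(1)]
    show ?thesis using u v by (simp only: presented_group_mult)
  qed
qed

section \<open>Free products\<close>

text \<open>The generators are the elements of the two factors, the relations their
  multiplication tables.\<close>

definition free_product ::
    "('a, 'm) monoid_scheme \<Rightarrow> ('b, 'n) monoid_scheme \<Rightarrow> ('a + 'b) word set monoid" where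
  "free_product G H = presented_group (carrier G <+> carrier H)
     ({(pos [Inl a, Inl b], pos [Inl (a \<otimes>\<^bsub>G\<^esub> b)]) | a b. a \<in> carrier G \<and> b \<in> carrier G} \<union>
      {(pos [Inr a, Inr b], pos [Inr (a \<otimes>\<^bsub>H\<^esub> b)]) | a b. a \<in> carrier H \<and> b \<in> carrier H})"

section \<open>The center\<close>

definition center :: "('a, 'm) monoid_scheme \<Rightarrow> 'a set" where
  "center G = {z \<in> carrier G. \<forall>x\<in>carrier G. z \<otimes>\<^bsub>G\<^esub> x = x \<otimes>\<^bsub>G\<^esub> z}"

lemma (in group) center_normal: "center G \<lhd> G"
proof -
  have "subgroup (center G) G"
  proof (rule subgroupI)
    show "center G \<noteq> {}"
    proof -
      have "\<one> \<in> center G" by (simp add: center_def)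
      then show ?thesis by blast
    qed
    show "inv a \<in> center G" if "a \<in> center G" for a
    proof -
      have "inv a \<otimes> x = x \<otimes> inv a" if x: "x \<in> carrier G" for x
      proof -
        have a: "a \<in> carrier G" and eq: "x \<otimes> a = a \<otimes> x"
          using \<open>a \<in> center G\<close> x by (auto simp: center_def)
        have "inv a \<otimes> x = inv a \<otimes> (x \<otimes> a) \<otimes> inv a" using a x by (simp add: m_assoc)
        also have "\<dots> = x \<otimes> inv a" unfolding eq using a x by (simp add: m_assoc[symmetric])
        finally show ?thesis .
      qed
      with that show ?thesis by (auto simp: center_def)
    qed
    show "a \<otimes> b \<in> center G" if "a \<in> center G" "b \<in> center G" for a b
    proof -
      have ab: "a \<in> carrier G" "b \<in> carrier G" using that by (auto simp: center_def)
      have "a \<otimes> b \<otimes> x = x \<otimes> (a \<otimes> b)" if x: "x \<in> carrier G" for x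
      proof -
        have "a \<otimes> b \<otimes> x = a \<otimes> (b \<otimes> x)" using ab x by (rule m_assoc)
        also have "b \<otimes> x = x \<otimes> b" using \<open>b \<in> center G\<close> x by (simp add: center_def)
        also have "a \<otimes> (x \<otimes> b) = a \<otimes> x \<otimes> b" using ab x by (simp add: m_assoc)
        also have "a \<otimes> x = x \<otimes> a" using \<open>a \<in> center G\<close> x by (simp add: center_def)
        also have "x \<otimes> a \<otimes> b = x \<otimes> (a \<otimes> b)" using ab x by (simp add: m_assoc)
        finally show ?thesis .
      qed
      with ab show ?thesis by (simp add: center_def)
    qed
  qed (auto simp: center_def)
  moreover have "x \<otimes> h \<otimes> inv x \<in> center G" if x: "x \<in> carrier G" and h: "h \<in> center G" for x h
  proof -
    have hc: "h \<in> carrier G" and eq: "x \<otimes> h = h \<otimes> x" using x h by (auto simp: center_def)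
    have "x \<otimes> h \<otimes> inv x = h" using x hc unfolding eq by (simp add: m_assoc)
    with h show ?thesis by simp
  qed
  ultimately show ?thesis unfolding normal_inv_iff by blast
qed

section \<open>Braid groups\<close>

text \<open>The Artin braid group on \<open>n\<close> strings, with generators \<open>1, \<dots>, n - 1\<close>
  standing for the elementary braids.\<close>

definition braid_rels :: "nat \<Rightarrow> (nat word \<times> nat word) set" where
  "braid_rels n =
     {(pos [i, i + 1, i], pos [i + 1, i, i + 1]) | i. 1 \<le> i \<and> i + 1 < n} \<union>
     {(pos [i, j], pos [j, i]) | i j. 1 \<le> i \<and> i + 1 < j \<and> j < n}"

definition braid_group :: "nat \<Rightarrow> nat word set monoid" where
  "braid_group n = presented_group {1..<n} (braid_rels n)"

definition braid_perm :: "nat \<Rightarrow> nat word set \<Rightarrow> nat \<Rightarrow> nat" where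
  "braid_perm n = pres_lift (sym_group n) (\<lambda>i. transpose i (i + 1))"

definition pure_braid_group :: "nat \<Rightarrow> nat word set monoid" where
  "pure_braid_group n =
     braid_group n \<lparr> carrier := kernel (braid_group n) (sym_group n) (braid_perm n) \<rparr>"

lemma braid_perm_hom: "braid_perm n \<in> hom (braid_group n) (sym_group n)"
  unfolding braid_perm_def braid_group_def
proof (rule group.pres_lift_hom[OF sym_group_is_group])
  show "(\<lambda>i. transpose i (i + 1)) \<in> {1..<n} \<rightarrow> carrier (sym_group n)"
    by (auto simp: sym_group_def intro!: permutes_swap_id)
  fix u v :: "nat word" assume "(u, v) \<in> braid_rels n"
  then show "word_eval (sym_group n) (\<lambda>i. transpose i (i + 1)) u =
             word_eval (sym_group n) (\<lambda>i. transpose i (i + 1)) v"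
    by (auto simp: braid_rels_def pos_def sym_group_def fun_eq_iff transpose_def)
qed

lemma group_pure_braid_group: "group (pure_braid_group n)"
proof -
  interpret group_hom "braid_group n" "sym_group n" "braid_perm n"
    by (intro group_hom.intro group_hom_axioms.intro braid_perm_hom sym_group_is_group)
       (simp add: braid_group_def group_presented_group)
  show ?thesis
    unfolding pure_braid_group_def
    by (rule subgroup.subgroup_is_group[OF subgroup_kernel]) simp
qed

definition pure_braid_group_mod_center :: "nat \<Rightarrow> nat word set set monoid" where
  "pure_braid_group_mod_center n = pure_braid_group n Mod center (pure_braid_group n)"

section \<open>The pure virtual braid group on three strings\<close>

text \<open>The generator \<open>x\<^sub>i\<^sub>j\<close> is the pair \<open>(i, j)\<close>.\<close>

definition vP3_gens :: "(nat \<times> nat) set" where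
  "vP3_gens = {(i, j). i \<in> {1..3} \<and> j \<in> {1..3} \<and> i \<noteq> j}"

definition vP3_rels :: "((nat \<times> nat) word \<times> (nat \<times> nat) word) set" where
  "vP3_rels = {(pos [(i, j), (i, k), (j, k)], pos [(j, k), (i, k), (i, j)]) | i j k.
     i \<in> {1..3} \<and> j \<in> {1..3} \<and> k \<in> {1..3} \<and> i \<noteq> j \<and> j \<noteq> k \<and> i \<noteq> k}"

definition vP3 :: "(nat \<times> nat) word set monoid" where
  "vP3 = presented_group vP3_gens vP3_rels"

end

theory Submission
  imports Defs
begin

text \<open>
  Put the generators of \<open>vP\<^sub>3\<close> in the cyclic order \<open>x\<^sub>1\<^sub>2, x\<^sub>1\<^sub>3, x\<^sub>2\<^sub>3, x\<^sub>2\<^sub>1, x\<^sub>3\<^sub>1, x\<^sub>3\<^sub>2\<close> and call them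
  \<open>y\<^sub>0, \<dots>, y\<^sub>5\<close>. The relations become \<open>y\<^sub>i y\<^sub>i\<^sub>+\<^sub>1 y\<^sub>i\<^sub>+\<^sub>2 = y\<^sub>i\<^sub>+\<^sub>2 y\<^sub>i\<^sub>+\<^sub>1 y\<^sub>i\<close> (indices modulo 6). Writing
  \<open>y\<^sub>i = Y\<^sub>i t\<close> for even and \<open>y\<^sub>i = t\<^sup>-\<^sup>1 Y\<^sub>i\<close> for odd \<open>i\<close>, where \<open>t = y\<^sub>0\<close>, the letter \<open>t\<close> drops out of
  the relations. Hence \<open>vP\<^sub>3\<close> is the free product of \<open>\<langle>t\<rangle>\<close> and the group generated by
  \<open>Y\<^sub>1, \<dots>, Y\<^sub>5\<close>, with the same relations for \<open>Y\<^sub>0 = 1\<close>. In terms of \<open>S = Y\<^sub>1\<close>, \<open>T = Y\<^sub>3\<close> and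
  \<open>U = Y\<^sub>1 Y\<^sub>2\<close>, \<open>Q = Y\<^sub>3 Y\<^sub>4\<close>, \<open>R = Y\<^sub>5\<close> that group is a semidirect product of the free group on
  \<open>U, Q, R\<close> by the free group on \<open>S, T\<close>, with trivial center.

  It is identified with the pure braid group modulo its center by the Reidemeister--Schreier
  method: a cocycle on the 24 cosets of the pure braid group gives a surjection from the pure
  braid group, and sending the generators to explicit pure braids inverts it up to the full
  twist. Identities between braids are verified by subword reversing, identities in the
  semidirect product by normal forms.
\<close>

section \<open>Presented groups\<close>

abbreviation word_class :: "'a set \<Rightarrow> ('a word \<times> 'a word) set \<Rightarrow> 'a word \<Rightarrow> 'a word set" where
  "word_class S R w \<equiv> pres_cong S R `` {w}"

lemma word_class_eq_iff:
  "u \<in> words S \<Longrightarrow> v \<in> words S \<Longrightarrow> word_class S R u = word_class S R v \<longleftrightarrow> (u, v) \<in> pres_cong S R"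
  by (metis equiv_pres_cong eq_equiv_class_iff)

lemma presented_group_one: "\<one>\<^bsub>presented_group S R\<^esub> = word_class S R []"
  by (simp add: presented_group_def)

lemma presented_group_inv:
  assumes "w \<in> words S"
  shows "inv\<^bsub>presented_group S R\<^esub> (word_class S R w) = word_class S R (inv_word w)"
proof (rule group.inv_equality[OF group_presented_group])
  have "word_class S R (inv_word w @ w) = word_class S R []"
    using inv_word_cancel[OF assms] by (rule equiv_class_eq[OF equiv_pres_cong])
  then show "word_class S R (inv_word w) \<otimes>\<^bsub>presented_group S R\<^esub> word_class S R w
      = \<one>\<^bsub>presented_group S R\<^esub>"
    using assms by (simp only: presented_group_mult inv_word_words presented_group_one)
qed (use assms in \<open>auto intro: presented_group_class_carrier inv_word_words\<close>)

lemma inv_word_single [simp]: "inv_word [(a, b)] = [(a, \<not> b)]"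
  by (simp add: inv_word_def)

lemma inv_word_Nil [simp]: "inv_word [] = []"
  by (simp add: inv_word_def)

lemma inv_word_Cons: "inv_word ((a, b) # w) = inv_word w @ [(a, \<not> b)]"
  by (simp add: inv_word_def)

lemma words_UNIV [simp]: "w \<in> words UNIV"
  by (simp add: words_def)

lemma pos_words [simp]: "pos as \<in> words S \<longleftrightarrow> set as \<subseteq> S"
  by (induction as) (auto simp: pos_def)

text \<open>With the generator classes as values, facts about \<open>word_eval\<close> in an
  arbitrary group become facts about congruent words.\<close>

lemma word_eval_classes:
  "w \<in> words S \<Longrightarrow>
    word_eval (presented_group S R) (\<lambda>a. word_class S R [(a, True)]) w = word_class S R w"
proof (induction w)
  case Nil
  then show ?case by (simp add: presented_group_one)
next
  case (Cons x w)
  obtain a b where x: "x = (a, b)" by force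
  then have ab: "[(a, b)] \<in> words S" "[(a, True)] \<in> words S" "w \<in> words S"
    using Cons.prems by auto
  have "(if b then word_class S R [(a, True)]
      else inv\<^bsub>presented_group S R\<^esub> (word_class S R [(a, True)])) = word_class S R [(a, b)]"
    using presented_group_inv[OF ab(2)] by simp
  then show ?case
    using Cons.IH ab presented_group_mult[OF ab(1,3), of R] x by simp
qed

lemma gen_class_funcset:
  "(\<lambda>a. word_class S R [(a, True)]) \<in> S \<rightarrow> carrier (presented_group S R)"
  by (auto intro!: presented_group_class_carrier)

lemma hom_word_eval:
  assumes "group G" "group H" "h \<in> hom G H" "f \<in> S \<rightarrow> carrier G" "w \<in> words S"
  shows "h (word_eval G f w) = word_eval H (\<lambda>a. h (f a)) w"
proof -
  interpret group_hom G H h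
    using assms by (simp add: group_hom_def group_hom_axioms_def)
  show ?thesis
    using assms(5)
  proof (induction w)
    case (Cons x w)
    obtain a b where x: "x = (a, b)" by force
    then have "f a \<in> carrier G" "word_eval G f w \<in> carrier G"
      using Cons.prems assms(4) by (auto intro!: G.word_eval_closed[OF assms(4)])
    then show ?case using Cons x by simp
  qed simp
qed

lemma word_eval_ext: "(\<And>a. a \<in> S \<Longrightarrow> f a = g a) \<Longrightarrow> w \<in> words S \<Longrightarrow> word_eval G f w = word_eval G g w"
  by (induction w) auto

lemma presented_group_hom_eqI:
  assumes "group H" "h \<in> hom (presented_group S R) H" "k \<in> hom (presented_group S R) H"
    and "\<And>a. a \<in> S \<Longrightarrow> h (word_class S R [(a, True)]) = k (word_class S R [(a, True)])"
    and "x \<in> carrier (presented_group S R)"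
  shows "h x = k x"
proof -
  obtain w where w: "w \<in> words S" "x = word_class S R w"
    using assms(5) by (rule presented_group_carrierE)
  have "h x = word_eval H (\<lambda>a. h (word_class S R [(a, True)])) w"
    using hom_word_eval[OF group_presented_group assms(1,2) gen_class_funcset w(1)]
    by (simp add: w word_eval_classes)
  also have "\<dots> = word_eval H (\<lambda>a. k (word_class S R [(a, True)])) w"
    using assms(4) w(1) by (rule word_eval_ext)
  also have "\<dots> = k x"
    using hom_word_eval[OF group_presented_group assms(1,3) gen_class_funcset w(1)]
    by (simp add: w word_eval_classes)
  finally show ?thesis .
qed

lemma presented_group_lift:
  assumes "group X" "f \<in> A \<rightarrow> carrier X"
    and "\<And>u v. (u, v) \<in> rels \<Longrightarrow> word_eval X f u = word_eval X f v"
  shows "\<exists>h \<in> hom (presented_group A rels) X. \<forall>a \<in> A. h (word_class A rels [(a, True)]) = f a"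
proof (intro bexI ballI)
  interpret group X by fact
  show "pres_lift X f \<in> hom (presented_group A rels) X"
    using assms by (intro pres_lift_hom)
  fix a assume a: "a \<in> A"
  have "pres_lift X f (word_class A rels [(a, True)]) = word_eval X f [(a, True)]"
    using assms a by (intro pres_lift_class) auto
  moreover have "f a \<in> carrier X" using assms(2) a by auto
  ultimately show "pres_lift X f (word_class A rels [(a, True)]) = f a" by simp
qed

lemma (in group) word_eval_inv_word:
  assumes "f \<in> S \<rightarrow> carrier G" "w \<in> words S"
  shows "word_eval G f (inv_word w) = inv (word_eval G f w)"
  using assms(2)
proof (induction w)
  case (Cons x w)
  obtain a b where x: "x = (a, b)" by force
  then have a: "f a \<in> carrier G" "a \<in> S" and w: "w \<in> words S"
    using Cons.prems assms(1) by auto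
  have "word_eval G f (inv_word w @ [(a, \<not> b)]) = inv (word_eval G f w) \<otimes> word_eval G f [(a, \<not> b)]"
    using Cons.IH w a by (subst word_eval_append[OF assms(1)]) (auto simp: inv_word_words)
  then show ?case
    using a word_eval_closed[OF assms(1) w] x
    by (auto simp: inv_word_Cons inv_mult_group)
qed simp

section \<open>Substitution of words for letters\<close>

definition subst :: "('a \<Rightarrow> 'b word) \<Rightarrow> 'a word \<Rightarrow> 'b word" where
  "subst \<phi> w = concat (map (\<lambda>(a, b). if b then \<phi> a else inv_word (\<phi> a)) w)"

lemma subst_simps [simp]:
  "subst \<phi> [] = []"
  "subst \<phi> ((a, b) # w) = (if b then \<phi> a else inv_word (\<phi> a)) @ subst \<phi> w"
  "subst \<phi> (u @ v) = subst \<phi> u @ subst \<phi> v"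
  by (auto simp: subst_def)

lemma subst_words:
  "(\<And>a. a \<in> S \<Longrightarrow> \<phi> a \<in> words S') \<Longrightarrow> w \<in> words S \<Longrightarrow> subst \<phi> w \<in> words S'"
  by (induction w) (auto simp: inv_word_words)

lemma (in group) word_eval_subst:
  assumes f: "f \<in> S' \<rightarrow> carrier G" and \<phi>: "\<And>a. a \<in> S \<Longrightarrow> \<phi> a \<in> words S'" and "w \<in> words S"
  shows "word_eval G f (subst \<phi> w) = word_eval G (\<lambda>a. word_eval G f (\<phi> a)) w"
  using assms(3)
proof (induction w)
  case (Cons x w)
  obtain a b where x: "x = (a, b)" by force
  then have a: "\<phi> a \<in> words S'" "subst \<phi> w \<in> words S'"
    using Cons.prems \<phi> by (auto intro: subst_words)
  then show ?case
    using Cons x by (auto simp: word_eval_append[OF f] inv_word_words word_eval_inv_word[OF f])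
qed simp

lemma (in group) word_eval_commute:
  assumes f: "f \<in> S \<rightarrow> carrier G" and x: "x \<in> carrier G"
    and c: "\<And>a. a \<in> S \<Longrightarrow> x \<otimes> f a = f a \<otimes> x" and "w \<in> words S"
  shows "x \<otimes> word_eval G f w = word_eval G f w \<otimes> x"
  using assms(4)
proof (induction w)
  case (Cons y w)
  obtain a b where y: "y = (a, b)" by force
  have a: "f a \<in> carrier G" "a \<in> S" and w: "word_eval G f w \<in> carrier G"
    using Cons.prems f y by (auto intro!: word_eval_closed[OF f])
  have "x \<otimes> g = g \<otimes> x" if "g = (if b then f a else inv (f a))" for g
  proof (cases b)
    case False
    have "f a \<otimes> (x \<otimes> inv (f a)) = f a \<otimes> (inv (f a) \<otimes> x)"
      using a x c[OF a(2)] by (metis m_assoc inv_closed r_inv l_one r_one)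
    then show ?thesis using a x that False by simp
  qed (use that c a in simp)
  then show ?case
    using Cons a w x y by (simp add: m_assoc[symmetric]) (metis Cons.IH a(1) inv_closed m_assoc)
qed (use x in simp)

lemma pres_cong_inv_word:
  assumes "(u, v) \<in> pres_cong S R"
  shows "(inv_word u, inv_word v) \<in> pres_cong S R"
proof -
  have uv: "u \<in> words S" "v \<in> words S" using pres_cong_words[OF assms] by auto
  then have "word_class S R u = word_class S R v" using assms by (simp add: word_class_eq_iff)
  then have "word_class S R (inv_word u) = word_class S R (inv_word v)"
    using uv by (simp only: presented_group_inv[symmetric])
  then show ?thesis using uv by (simp add: word_class_eq_iff inv_word_words)
qed

lemma pres_cong_subst_pointwise:
  assumes "\<And>a. a \<in> S \<Longrightarrow> (\<phi> a, \<psi> a) \<in> pres_cong S' R" "w \<in> words S"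
  shows "(subst \<phi> w, subst \<psi> w) \<in> pres_cong S' R"
  using assms(2)
proof (induction w)
  case (Cons x w)
  then show ?case
    using assms(1)[of "fst x"] by (cases x) (auto intro: pres_cong_append pres_cong_inv_word)
qed (simp add: pres_cong.refl)

lemma subst_subst: "subst \<phi> (subst \<psi> w) = subst (\<lambda>a. subst \<phi> (\<psi> a)) w"
proof (induction w)
  case (Cons x w)
  have "subst \<phi> (inv_word v) = inv_word (subst \<phi> v)" for v
    by (induction v) (auto simp: inv_word_def subst_def split: prod.splits simp: comp_def case_prod_beta rev_map)
  then show ?case using Cons by (cases x) auto
qed simp

lemma subst_id: "subst (\<lambda>a. [(a, True)]) w = w"
  by (induction w) auto

lemma pres_cong_inverse:
  assumes "u \<in> words S"
  shows "(u @ inv_word u, []) \<in> pres_cong S R" "(inv_word u @ u, []) \<in> pres_cong S R"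
proof -
  have "inv_word (inv_word u) = u"
    by (auto simp: inv_word_def rev_map comp_def case_prod_beta)
  then show "(u @ inv_word u, []) \<in> pres_cong S R"
    using inv_word_cancel[OF inv_word_words[OF assms], of R] by simp
qed (rule inv_word_cancel[OF assms])

text \<open>A substitution is a homomorphism from the free group on \<open>S\<close>: a cancelling
  pair of letters becomes a word followed by its formal inverse, which is trivial for every relation
  set \<open>R\<close>.\<close>

lemma pres_cong_subst:
  assumes "(u, v) \<in> pres_cong S {}" "\<And>a. a \<in> S \<Longrightarrow> \<phi> a \<in> words S'"
  shows "(subst \<phi> u, subst \<phi> v) \<in> pres_cong S' R"
  using assms(1)
proof (induction rule: pres_cong.induct)
  case (refl w)
  then show ?case using assms(2) by (intro pres_cong.refl subst_words)
next
  case (trans u v w)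
  then show ?case by (meson pres_cong.trans)
next
  case (cancel xs ys a b)
  have "((if b then \<phi> a else inv_word (\<phi> a)) @ (if \<not> b then \<phi> a else inv_word (\<phi> a)), [])
      \<in> pres_cong S' R"
    using pres_cong_inverse[of "\<phi> a" S' R] assms(2) cancel by (cases b) auto
  moreover have "subst \<phi> xs \<in> words S'" "subst \<phi> ys \<in> words S'"
    using cancel assms(2) by (auto intro: subst_words)
  ultimately show ?case
    using pres_cong_context[of _ "[]" S' R "subst \<phi> xs" "subst \<phi> ys"] by fastforce
qed (auto intro: pres_cong.sym)

text \<open>The equation \<open>a \<otimes> b = c \<otimes> a\<close> says that \<open>a\<close>
  conjugates \<open>b\<close> to \<open>c\<close>, so it also conjugates inverse to inverse.\<close>

lemma (in group) intertwine_inv_right: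
  assumes "a \<otimes> b = c \<otimes> a" "a \<in> carrier G" "b \<in> carrier G" "c \<in> carrier G"
  shows "a \<otimes> inv b = inv c \<otimes> a"
proof -
  have "a \<otimes> inv b = inv c \<otimes> (c \<otimes> a) \<otimes> inv b"
    using assms(2-4) by (simp add: m_assoc[symmetric])
  also have "\<dots> = inv c \<otimes> a"
    unfolding assms(1)[symmetric] using assms(2-4) by (simp add: m_assoc)
  finally show ?thesis .
qed

lemma (in group) intertwine_inv_left:
  assumes "a \<otimes> b = c \<otimes> a" "a \<in> carrier G" "b \<in> carrier G" "c \<in> carrier G"
  shows "inv a \<otimes> c = b \<otimes> inv a"
proof -
  have "inv a \<otimes> c = inv a \<otimes> (c \<otimes> a) \<otimes> inv a"
    using assms(2-4) by (simp add: m_assoc)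
  also have "\<dots> = b \<otimes> inv a"
    unfolding assms(1)[symmetric] using assms(2-4) by (simp add: m_assoc[symmetric])
  finally show ?thesis .
qed

section \<open>Free products\<close>

abbreviation free_product_rels ::
    "('a, 'm) monoid_scheme \<Rightarrow> ('b, 'n) monoid_scheme \<Rightarrow> (('a + 'b) word \<times> ('a + 'b) word) set" where
  "free_product_rels G H \<equiv>
     {(pos [Inl a, Inl b], pos [Inl (a \<otimes>\<^bsub>G\<^esub> b)]) | a b. a \<in> carrier G \<and> b \<in> carrier G} \<union>
     {(pos [Inr a, Inr b], pos [Inr (a \<otimes>\<^bsub>H\<^esub> b)]) | a b. a \<in> carrier H \<and> b \<in> carrier H}"

definition free_gen ::
    "('a, 'm) monoid_scheme \<Rightarrow> ('b, 'n) monoid_scheme \<Rightarrow> 'a + 'b \<Rightarrow> ('a + 'b) word set" where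
  "free_gen G H x = word_class (carrier G <+> carrier H) (free_product_rels G H) [(x, True)]"

lemma group_free_product: "group (free_product G H)"
  unfolding free_product_def by (rule group_presented_group)

lemma free_gen_carrier:
  "x \<in> carrier G <+> carrier H \<Longrightarrow> free_gen G H x \<in> carrier (free_product G H)"
  unfolding free_gen_def free_product_def by (rule presented_group_class_carrier) simp

lemma free_gen_mult:
  assumes "x \<in> carrier G <+> carrier H" "y \<in> carrier G <+> carrier H" "z \<in> carrier G <+> carrier H"
    and "(pos [x, y], pos [z]) \<in> free_product_rels G H"
  shows "free_gen G H x \<otimes>\<^bsub>free_product G H\<^esub> free_gen G H y = free_gen G H z"
proof -
  let ?S = "carrier G <+> carrier H" and ?R = "free_product_rels G H"
  have "([] @ pos [x, y] @ [], [] @ pos [z] @ []) \<in> pres_cong ?S ?R"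
    by (rule pres_cong.rel[OF _ _ _ _ assms(4)]) (use assms(1-3) in simp_all)
  then have "word_class ?S ?R (pos [x, y]) = word_class ?S ?R (pos [z])"
    by (intro equiv_class_eq[OF equiv_pres_cong]) simp
  moreover have "word_class ?S ?R ([(x, True)] @ [(y, True)])
      = word_class ?S ?R [(x, True)] \<otimes>\<^bsub>presented_group ?S ?R\<^esub> word_class ?S ?R [(y, True)]"
    by (rule presented_group_mult[symmetric]) (use assms(1-3) in auto)
  ultimately show ?thesis
    unfolding free_gen_def free_product_def by (simp add: pos_def)
qed

lemma free_gen_Inl_hom:
  assumes "group G"
  shows "(\<lambda>a. free_gen G H (Inl a)) \<in> hom G (free_product G H)"
proof (rule homI)
  interpret group G by fact
  fix a b assume ab: "a \<in> carrier G" "b \<in> carrier G"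
  then have "(pos [Inl a, Inl b], pos [Inl (a \<otimes>\<^bsub>G\<^esub> b)]) \<in> free_product_rels G H" by blast
  then show "free_gen G H (Inl (a \<otimes>\<^bsub>G\<^esub> b))
      = free_gen G H (Inl a) \<otimes>\<^bsub>free_product G H\<^esub> free_gen G H (Inl b)"
    using ab by (intro free_gen_mult[symmetric]) auto
qed (auto intro: free_gen_carrier)

lemma free_gen_Inr_hom:
  assumes "group H"
  shows "(\<lambda>a. free_gen G H (Inr a)) \<in> hom H (free_product G H)"
proof (rule homI)
  interpret group H by fact
  fix a b assume ab: "a \<in> carrier H" "b \<in> carrier H"
  then have "(pos [Inr a, Inr b], pos [Inr (a \<otimes>\<^bsub>H\<^esub> b)]) \<in> free_product_rels G H" by blast
  then show "free_gen G H (Inr (a \<otimes>\<^bsub>H\<^esub> b))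
      = free_gen G H (Inr a) \<otimes>\<^bsub>free_product G H\<^esub> free_gen G H (Inr b)"
    using ab by (intro free_gen_mult[symmetric]) auto
qed (auto intro: free_gen_carrier)

text \<open>Universal property: \<open>case_sum f g\<close> respects both multiplication tables
  because \<open>f\<close> and \<open>g\<close> are homomorphisms.\<close>

lemma free_product_lift:
  assumes "group X" "f \<in> hom G X" "g \<in> hom H X"
  obtains h where "h \<in> hom (free_product G H) X"
    "\<And>a. a \<in> carrier G \<Longrightarrow> h (free_gen G H (Inl a)) = f a"
    "\<And>b. b \<in> carrier H \<Longrightarrow> h (free_gen G H (Inr b)) = g b"
proof -
  interpret group X by fact
  have cl: "case_sum f g \<in> carrier G <+> carrier H \<rightarrow> carrier X"
    using assms(2,3) by (auto simp: hom_def)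
  have "word_eval X (case_sum f g) u = word_eval X (case_sum f g) v"
    if "(u, v) \<in> free_product_rels G H" for u v
    using that assms(2,3) by (auto simp: pos_def hom_def Pi_iff)
  then have "\<exists>h \<in> hom (presented_group (carrier G <+> carrier H) (free_product_rels G H)) X.
      \<forall>x \<in> carrier G <+> carrier H.
        h (word_class (carrier G <+> carrier H) (free_product_rels G H) [(x, True)]) = case_sum f g x"
    by (intro presented_group_lift[OF assms(1) cl])
  then obtain h
    where "h \<in> hom (presented_group (carrier G <+> carrier H) (free_product_rels G H)) X"
      and h: "\<And>x. x \<in> carrier G <+> carrier H \<Longrightarrow> h (free_gen G H x) = case_sum f g x"
    unfolding free_gen_def by blast
  then have "h \<in> hom (free_product G H) X" by (simp add: free_product_def)
  then show ?thesis by (rule that) (use h[OF InlI] h[OF InrI] in auto)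
qed

lemma free_product_hom_eqI:
  assumes "group X" "h \<in> hom (free_product G H) X" "k \<in> hom (free_product G H) X"
    and "\<And>a. a \<in> carrier G \<Longrightarrow> h (free_gen G H (Inl a)) = k (free_gen G H (Inl a))"
    and "\<And>b. b \<in> carrier H \<Longrightarrow> h (free_gen G H (Inr b)) = k (free_gen G H (Inr b))"
    and "x \<in> carrier (free_product G H)"
  shows "h x = k x"
  by (rule presented_group_hom_eqI[OF assms(1) assms(2,3)[unfolded free_product_def] _
        assms(6)[unfolded free_product_def]])
    (use assms(4,5) in \<open>auto simp: free_gen_def\<close>)

section \<open>Reduced words\<close>

abbreviation flip :: "'a \<times> bool \<Rightarrow> 'a \<times> bool" where
  "flip x \<equiv> (fst x, \<not> snd x)"

definition cons_red :: "'a \<times> bool \<Rightarrow> 'a word \<Rightarrow> 'a word" where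
  "cons_red x w = (case w of [] \<Rightarrow> [x] | y # ys \<Rightarrow> if y = flip x then ys else x # w)"

definition reduce :: "'a word \<Rightarrow> 'a word" where
  "reduce w = foldr cons_red w []"

abbreviation reduced :: "'a word \<Rightarrow> bool" where
  "reduced \<equiv> successively (\<lambda>x y. y \<noteq> flip x)"

lemma reduce_simps [simp]:
  "reduce [] = []" "reduce (x # w) = cons_red x (reduce w)"
  by (auto simp: reduce_def)

lemma cons_red_irreducible: "w = [] \<or> hd w \<noteq> flip x \<Longrightarrow> cons_red x w = x # w"
  by (cases w) (auto simp: cons_red_def)

lemma reduced_cons_red: "reduced w \<Longrightarrow> reduced (cons_red x w)"
  by (cases w) (auto simp: cons_red_def successively_Cons split: list.split)

lemma reduced_reduce: "reduced (reduce w)"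
  by (induction w) (auto simp: reduced_cons_red)

text \<open>On reduced words a letter and its inverse act by mutually inverse operations, so the
  free group acts on reduced words. The invariance of \<open>reduce\<close> under congruence rests
  on this.\<close>

lemma cons_red_flip: "reduced w \<Longrightarrow> cons_red x (cons_red (flip x) w) = w"
  by (cases w) (auto simp: cons_red_def successively_Cons split: list.split)

lemma reduce_append: "reduce (u @ v) = foldr cons_red u (reduce v)"
  by (simp add: reduce_def)

lemma reduce_cong: "(u, v) \<in> pres_cong S {} \<Longrightarrow> reduce u = reduce v"
proof (induction rule: pres_cong.induct)
  case (cancel xs ys a b)
  then show ?case
    using cons_red_flip[OF reduced_reduce, of "(a, b)" ys] by (simp add: reduce_append)
qed simp_all

lemma cons_red_words: "fst x \<in> S \<Longrightarrow> w \<in> words S \<Longrightarrow> cons_red x w \<in> words S"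
  by (auto simp: cons_red_def split: list.split)

lemma reduce_words: "w \<in> words S \<Longrightarrow> reduce w \<in> words S"
  by (induction w) (auto simp: cons_red_words)

lemma (in group) word_eval_cons_red:
  assumes f: "f \<in> S \<rightarrow> carrier G" and "fst x \<in> S" "w \<in> words S"
  shows "word_eval G f (cons_red x w) = word_eval G f (x # w)"
proof (cases "\<exists>ys. w = flip x # ys")
  case True
  then obtain ys where ys: "w = flip x # ys" by blast
  then have "f (fst x) \<in> carrier G" "word_eval G f ys \<in> carrier G"
    using assms by (auto intro!: word_eval_closed[OF f])
  then show ?thesis
    using ys by (cases x) (auto simp: cons_red_def m_assoc[symmetric])
next
  case False
  then have "cons_red x w = x # w" by (auto simp: cons_red_def split: list.split)
  then show ?thesis by simp
qed

lemma (in group) word_eval_reduce: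
  assumes f: "f \<in> S \<rightarrow> carrier G" and "w \<in> words S"
  shows "word_eval G f (reduce w) = word_eval G f w"
  using assms(2)
proof (induction w)
  case (Cons x w)
  then have "word_eval G f (reduce (x # w)) = word_eval G f (x # reduce w)"
    using word_eval_cons_red[OF f] reduce_words by fastforce
  then show ?case using Cons by (cases x) simp
qed simp

text \<open>Evaluation in the presented group itself does not notice free reduction, whatever the
  relations are.\<close>

lemma pres_cong_reduce:
  assumes "w \<in> words S"
  shows "(w, reduce w) \<in> pres_cong S R"
proof -
  have "word_class S R w = word_class S R (reduce w)"
    using group.word_eval_reduce[OF group_presented_group gen_class_funcset assms, of R]
    by (simp only: word_eval_classes reduce_words assms)
  then show ?thesis
    by (simp only: word_class_eq_iff reduce_words assms)
qed

text \<open>\<open>cons_red\<close> multiplies on the left only. For a letter multiplied on the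
  right of a reduced word, cancellation can reach no further than the last letter.\<close>

lemma foldr_cons_red_reduced:
  "reduced w \<Longrightarrow> foldr cons_red w [x] = (if w \<noteq> [] \<and> last w = flip x then butlast w else w @ [x])"
proof (induction w)
  case (Cons y w)
  show ?case
  proof (cases "w = []")
    case True
    then show ?thesis by (cases x; cases y) (auto simp: cons_red_def)
  next
    case False
    then have r: "reduced w" "hd w \<noteq> flip y"
      using Cons.prems by (auto simp: successively_Cons)
    obtain z w' where w: "w = z # w'" using False by (cases w) auto
    have "butlast w = [] \<or> hd (butlast w) \<noteq> flip y" "hd (w @ [x]) \<noteq> flip y"
      using r(2) by (simp_all add: w)
    then have "cons_red y (butlast w) = y # butlast w" "cons_red y (w @ [x]) = y # w @ [x]"
      by (metis cons_red_irreducible)+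
    then show ?thesis
      using Cons.IH[OF r(1)] False by simp
  qed
qed (simp add: cons_red_def)

text \<open>Suppose the reduced form is nonempty. One of two distinct generators differs from the
  generator in its first letter, so multiplying by it on the left causes no cancellation. By
  commutation the product on the right has the same length, so nothing cancels there either; but
  then the two products start with different letters.\<close>

lemma free_group_center_trivial:
  assumes ab: "a \<in> S" "b \<in> S" "a \<noteq> b" and w: "w \<in> words S"
    and comm: "\<And>g. g \<in> S \<Longrightarrow> (w @ [(g, True)], (g, True) # w) \<in> pres_cong S {}"
  shows "reduce w = []"
proof (rule ccontr)
  assume ne: "reduce w \<noteq> []"
  define r where "r = reduce w"
  have r: "reduced r" "r \<noteq> []" using ne reduced_reduce by (auto simp: r_def)
  obtain g where g: "g \<in> S" "g \<noteq> fst (hd r)" using ab by metis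
  let ?x = "(g, True)"
  have "reduce (w @ [?x]) = cons_red ?x r"
    using reduce_cong[OF comm[OF g(1)]] by (simp add: r_def)
  also have "\<dots> = ?x # r"
    using r g by (cases r) (auto simp: cons_red_def)
  finally have 1: "reduce (w @ [?x]) = ?x # r" .
  have c: "(w, r) \<in> pres_cong S {}"
    unfolding r_def using w by (rule pres_cong_reduce)
  have "reduce (w @ [?x]) = reduce (r @ [?x])"
    using pres_cong_context[OF c, of "[]" "[?x]"] g by (auto intro: reduce_cong)
  also have "\<dots> = foldr cons_red r [?x]"
    by (simp add: reduce_append cons_red_def)
  also have "\<dots> = (if r \<noteq> [] \<and> last r = flip ?x then butlast r else r @ [?x])"
    using r(1) by (rule foldr_cons_red_reduced)
  finally have "?x # r = (if r \<noteq> [] \<and> last r = flip ?x then butlast r else r @ [?x])"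
    unfolding 1 .
  then have "?x # r = r @ [?x]"
    by (auto dest: arg_cong[where f = length] split: if_splits)
  then have "hd (?x # r) = hd (r @ [?x])" by (rule arg_cong)
  with g(2) r(2) show False by (cases r) auto
qed

section \<open>A semidirect product of free groups\<close>

datatype qgen = U | Q | R | S | T | Z

abbreviation fib :: "qgen set" where "fib \<equiv> {U, Q, R}"
abbreviation base :: "qgen set" where "base \<equiv> {S, T}"

text \<open>\<open>conj_fib (h, e) n\<close> expresses the conjugate \<open>h\<^sup>e n h\<^sup>-\<^sup>e\<close> as a word in the fibre: \<open>S\<close>
  conjugates \<open>Q\<close> by \<open>R U\<close>, and \<open>T\<close> conjugates both \<open>Q\<close> and \<open>R\<close> by \<open>Q R\<close>.\<close>

fun conj_fib :: "qgen \<times> bool \<Rightarrow> qgen \<Rightarrow> qgen word" where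
  "conj_fib (S, True) Q = [(R, True), (U, True), (Q, True), (U, False), (R, False)]"
| "conj_fib (S, False) Q = [(U, False), (R, False), (Q, True), (R, True), (U, True)]"
| "conj_fib (T, True) Q = [(Q, True), (R, True), (Q, True), (R, False), (Q, False)]"
| "conj_fib (T, True) R = [(Q, True), (R, True), (Q, False)]"
| "conj_fib (T, False) Q = [(R, False), (Q, True), (R, True)]"
| "conj_fib (T, False) R = [(R, False), (Q, False), (R, True), (Q, True), (R, True)]"
| "conj_fib x n = [(n, True)]"

text \<open>The generator \<open>Z\<close> is killed; it is there to receive the full twist of the braid group.\<close>

definition qrels :: "(qgen word \<times> qgen word) set" where
  "qrels = insert ([(Z, True)], [])
     {([(h, True), (n, True)], conj_fib (h, True) n @ [(h, True)]) | h n. h \<in> base \<and> n \<in> fib}"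

definition qgroup :: "qgen word set monoid" where
  "qgroup = presented_group UNIV qrels"

interpretation Q: group qgroup
  unfolding qgroup_def by (rule group_presented_group)

abbreviation qclass :: "qgen word \<Rightarrow> qgen word set" where
  "qclass \<equiv> word_class UNIV qrels"

lemma qclass_carrier [simp]: "qclass w \<in> carrier qgroup"
  by (simp add: qgroup_def presented_group_class_carrier)

lemma qclass_append: "qclass (u @ v) = qclass u \<otimes>\<^bsub>qgroup\<^esub> qclass v"
  by (simp add: qgroup_def presented_group_mult)

lemma qclass_inv: "qclass (inv_word u) = inv\<^bsub>qgroup\<^esub> qclass u"
  by (simp add: qgroup_def presented_group_inv)

lemma qclass_Nil: "qclass [] = \<one>\<^bsub>qgroup\<^esub>"
  by (simp add: qgroup_def presented_group_one)

lemma qclass_eq_iff: "qclass u = qclass v \<longleftrightarrow> (u, v) \<in> pres_cong UNIV qrels"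
  by (simp add: word_class_eq_iff)

lemma qclass_reduce: "qclass (reduce w) = qclass w"
  by (metis qclass_eq_iff pres_cong_reduce words_UNIV)

lemma qclass_cons_red: "qclass (cons_red x w) = qclass (x # w)"
  using group.word_eval_cons_red[OF group_presented_group gen_class_funcset, of x UNIV w qrels]
  by (simp only: word_eval_classes words_UNIV) simp

lemma qclass_rel: "(u, v) \<in> qrels \<Longrightarrow> qclass u = qclass v"
  using pres_cong.rel[of "[]" UNIV "[]" u v qrels] by (simp add: qclass_eq_iff)

lemma conj_fib_words: "n \<in> fib \<Longrightarrow> conj_fib x n \<in> words fib"
  by (cases "(x, n)" rule: conj_fib.cases) auto

text \<open>\<open>S\<close> fixes \<open>U\<close> and \<open>R\<close>, and \<open>T\<close> fixes
  the product of \<open>Q\<close> and \<open>R\<close>. Each base generator thus fixes the word it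
  conjugates by, and its inverse conjugates by the inverse word.\<close>

lemma subst_conj_fib_inverse:
  assumes "h \<in> base" "n \<in> fib"
  shows "reduce (subst (conj_fib (h, b)) (conj_fib (h, \<not> b) n)) = [(n, True)]"
  using assms by (cases b) (auto simp: cons_red_def inv_word_def)

lemma qclass_conj_pos:
  assumes "h \<in> base" "w \<in> words fib"
  shows "qclass ((h, True) # w) = qclass (subst (conj_fib (h, True)) w @ [(h, True)])"
  using assms(2)
proof (induction w)
  case (Cons x w)
  obtain n b where x: "x = (n, b)" by force
  then have n: "n \<in> fib" "w \<in> words fib" using Cons.prems by auto
  let ?h = "qclass [(h, True)]" and ?n = "qclass [(n, True)]" and ?c = "qclass (conj_fib (h, True) n)"
  have r: "?h \<otimes>\<^bsub>qgroup\<^esub> ?n = ?c \<otimes>\<^bsub>qgroup\<^esub> ?h"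
    unfolding qclass_append[symmetric] append.simps
    by (rule qclass_rel) (use assms(1) n in \<open>auto simp: qrels_def\<close>)
  then have ri: "?h \<otimes>\<^bsub>qgroup\<^esub> inv\<^bsub>qgroup\<^esub> ?n = inv\<^bsub>qgroup\<^esub> ?c \<otimes>\<^bsub>qgroup\<^esub> ?h"
    by (intro Q.intertwine_inv_right) simp_all
  have "?h \<otimes>\<^bsub>qgroup\<^esub> qclass [x] = qclass (subst (conj_fib (h, True)) [x]) \<otimes>\<^bsub>qgroup\<^esub> ?h"
    using r ri qclass_inv[of "[(n, True)]"] by (cases b) (auto simp: x qclass_inv)
  moreover have "?h \<otimes>\<^bsub>qgroup\<^esub> qclass w = qclass (subst (conj_fib (h, True)) w) \<otimes>\<^bsub>qgroup\<^esub> ?h"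
    using Cons.IH n by (simp add: qclass_append[symmetric])
  moreover have "qclass ((h, True) # x # w) = ?h \<otimes>\<^bsub>qgroup\<^esub> (qclass [x] \<otimes>\<^bsub>qgroup\<^esub> qclass w)"
    by (simp add: qclass_append[symmetric])
  moreover have "qclass (subst (conj_fib (h, True)) (x # w) @ [(h, True)])
      = qclass (subst (conj_fib (h, True)) [x]) \<otimes>\<^bsub>qgroup\<^esub>
        (qclass (subst (conj_fib (h, True)) w) \<otimes>\<^bsub>qgroup\<^esub> ?h)"
    by (simp add: qclass_append[symmetric] x)
  ultimately show ?case
    by (metis Q.m_assoc qclass_carrier)
qed simp

lemma qclass_conj:
  assumes "h \<in> base" "w \<in> words fib"
  shows "qclass ((h, b) # w) = qclass (subst (conj_fib (h, b)) w @ [(h, b)])"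
proof (cases b)
  case False
  \<comment> \<open>The positive case carries \<open>?v\<close> back to \<open>w\<close>; the
    resulting equation is then solved for the inverse letter.\<close>
  let ?v = "subst (conj_fib (h, False)) w" and ?h = "qclass [(h, True)]"
  have "qclass ((h, True) # ?v) = qclass (subst (conj_fib (h, True)) ?v @ [(h, True)])"
    using assms by (intro qclass_conj_pos subst_words[OF conj_fib_words])
  moreover have "qclass (subst (conj_fib (h, True)) ?v) = qclass w"
  proof -
    have "(subst (conj_fib (h, True)) (conj_fib (h, False) n), [(n, True)]) \<in> pres_cong UNIV qrels"
      if "n \<in> fib" for n
      using subst_conj_fib_inverse[OF assms(1) that, of True]
        pres_cong_reduce[of "subst (conj_fib (h, True)) (conj_fib (h, False) n)" UNIV qrels]
      by simp
    from pres_cong_subst_pointwise[of _ _ "\<lambda>n. [(n, True)]", OF this assms(2)] show ?thesis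
      by (simp only: subst_subst subst_id qclass_eq_iff)
  qed
  ultimately have "qclass ((h, True) # ?v) = qclass (w @ [(h, True)])"
    by (simp add: qclass_append)
  then have "?h \<otimes>\<^bsub>qgroup\<^esub> qclass ?v = qclass w \<otimes>\<^bsub>qgroup\<^esub> ?h"
    by (simp add: qclass_append[symmetric])
  then have "inv\<^bsub>qgroup\<^esub> ?h \<otimes>\<^bsub>qgroup\<^esub> qclass w = qclass ?v \<otimes>\<^bsub>qgroup\<^esub> inv\<^bsub>qgroup\<^esub> ?h"
    by (intro Q.intertwine_inv_left) simp_all
  then show ?thesis
    using False by (simp add: qclass_append[symmetric] qclass_inv[symmetric])
qed (use assms qclass_conj_pos in simp)

section \<open>Normal forms: a fibre word followed by a base word\<close>

definition nf_step :: "qgen \<times> bool \<Rightarrow> qgen word \<times> qgen word \<Rightarrow> qgen word \<times> qgen word" where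
  "nf_step x p = (case p of (n, h) \<Rightarrow>
     if fst x \<in> base then (reduce (subst (conj_fib x) n), cons_red x h)
     else if fst x = Z then (n, h) else (cons_red x n, h))"

definition nf :: "qgen word \<Rightarrow> qgen word \<times> qgen word" where
  "nf w = foldr nf_step w ([], [])"

lemma nf_simps [simp]: "nf [] = ([], [])" "nf (x # w) = nf_step x (nf w)"
  by (auto simp: nf_def)

lemma qclass_Cons: "qclass (x # w) = qclass [x] \<otimes>\<^bsub>qgroup\<^esub> qclass w"
  by (simp add: qclass_append[symmetric])

lemma qclass_Z: "qclass [(Z, b)] = \<one>\<^bsub>qgroup\<^esub>"
proof -
  have "qclass [(Z, True)] = \<one>\<^bsub>qgroup\<^esub>"
    unfolding qclass_Nil[symmetric] by (rule qclass_rel) (simp add: qrels_def)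
  then show ?thesis
    using qclass_inv[of "[(Z, True)]"] by (cases b) auto
qed

text \<open>A base letter moves past the fibre part by conjugating it and then joins the base part;
  a fibre letter joins the fibre part; \<open>Z\<close> is trivial. Equal normal forms therefore
  certify equality in \<open>qgroup\<close>.\<close>

lemma nf_sound: "fst (nf w) \<in> words fib \<and> qclass w = qclass (fst (nf w) @ snd (nf w))"
proof (induction w)
  case (Cons x w)
  obtain g b where x: "x = (g, b)" by force
  obtain n h where nh: "nf w = (n, h)" by force
  then have n: "n \<in> words fib" and w: "qclass w = qclass (n @ h)" using Cons by auto
  have xw: "qclass (x # w) = qclass ((x # n) @ h)"
    unfolding append_Cons qclass_Cons[of x w] qclass_Cons[of x "n @ h"] w ..
  consider "g \<in> base" | "g = Z" | "g \<in> fib" by (cases g) auto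
  then show ?case
  proof cases
    case 1
    note xw
    also have "qclass ((x # n) @ h) = qclass ((subst (conj_fib x) n @ [x]) @ h)"
      using qclass_conj[OF 1 n] x by (simp only: qclass_append)
    also have "\<dots> = qclass (subst (conj_fib x) n @ (x # h))"
      by simp
    also have "\<dots> = qclass (reduce (subst (conj_fib x) n) @ cons_red x h)"
      by (simp only: qclass_append qclass_reduce qclass_cons_red)
    finally have "qclass (x # w) = qclass (reduce (subst (conj_fib x) n) @ cons_red x h)" .
    moreover have "nf (x # w) = (reduce (subst (conj_fib x) n), cons_red x h)"
      using 1 nh x by (simp add: nf_step_def)
    moreover have "reduce (subst (conj_fib x) n) \<in> words fib"
      by (rule reduce_words[OF subst_words[OF conj_fib_words n]])
    ultimately show ?thesis by (simp only: fst_conv snd_conv)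
  next
    case 2
    have "qclass (x # w) = qclass (n @ h)"
      using 2 x unfolding qclass_Cons[of x w] w by (simp add: qclass_Z)
    moreover have "nf (x # w) = (n, h)"
      using 2 nh x by (simp add: nf_step_def)
    ultimately show ?thesis using n by (simp only: fst_conv snd_conv)
  next
    case 3
    have "qclass (x # w) = qclass (cons_red x n @ h)"
      unfolding xw qclass_append qclass_cons_red ..
    moreover have "nf (x # w) = (cons_red x n, h)"
      using 3 nh x by (auto simp: nf_step_def)
    moreover have "cons_red x n \<in> words fib"
      using 3 x n by (intro cons_red_words) auto
    ultimately show ?thesis by (simp only: fst_conv snd_conv)
  qed
qed simp

lemma nf_eq_imp: "nf u = nf v \<Longrightarrow> qclass u = qclass v"
  by (metis nf_sound)

section \<open>The braid group on four strings\<close>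

text \<open>Subword reversing: every factor \<open>\<sigma>\<^sub>i\<^sup>-\<^sup>1 \<sigma>\<^sub>j\<close> is replaced by an equal positive-negative word, so
  that iteration turns a word into \<open>N D\<^sup>-\<^sup>1\<close> with \<open>N\<close> and \<open>D\<close> positive. The word is trivial
  iff reversing \<open>D\<^sup>-\<^sup>1 N\<close> gives the empty word; only soundness is needed here.\<close>

fun rev_pass :: "nat word \<Rightarrow> nat word" where
  "rev_pass ((i, False) # (j, True) # w) =
     (if i = j then rev_pass w
      else if i = Suc j \<or> j = Suc i
      then (j, True) # (i, True) # (j, False) # (i, False) # rev_pass w
      else (j, True) # (i, False) # rev_pass w)"
| "rev_pass (x # w) = x # rev_pass w"
| "rev_pass [] = []"

fun rev_iter :: "nat \<Rightarrow> nat word \<Rightarrow> nat word" where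
  "rev_iter 0 w = w"
| "rev_iter (Suc k) w = (let v = rev_pass w in if v = w then w else rev_iter k v)"

definition rev_trivial :: "nat word \<Rightarrow> bool" where
  "rev_trivial w \<longleftrightarrow> (let v = rev_iter 100 w in
     rev_iter 100 (dropWhile snd v @ takeWhile snd v) = [])"

section \<open>Braid classes and the soundness of reversing\<close>

definition bgens :: "nat set" where
  "bgens = {1..<4}"

lemma bgens_iff [simp]: "i \<in> bgens \<longleftrightarrow> i = 1 \<or> i = 2 \<or> i = 3"
  by (auto simp: bgens_def)

abbreviation bwords :: "nat word set" where
  "bwords \<equiv> words bgens"

definition bclass :: "nat word \<Rightarrow> nat word set" where
  "bclass w = word_class bgens (braid_rels 4) w"

abbreviation braid_mult :: "nat word set \<Rightarrow> nat word set \<Rightarrow> nat word set" (infixl "\<cdot>" 70) where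
  "x \<cdot> y \<equiv> x \<otimes>\<^bsub>braid_group 4\<^esub> y"

interpretation B: group "braid_group 4"
  unfolding braid_group_def by (rule group_presented_group)

lemma braid_group_4: "braid_group 4 = presented_group bgens (braid_rels 4)"
  by (simp add: braid_group_def bgens_def)

lemma bclass_carrier [simp]: "w \<in> bwords \<Longrightarrow> bclass w \<in> carrier (braid_group 4)"
  unfolding braid_group_4 bclass_def by (rule presented_group_class_carrier)

lemma bclass_append: "u \<in> bwords \<Longrightarrow> v \<in> bwords \<Longrightarrow> bclass (u @ v) = bclass u \<cdot> bclass v"
  unfolding braid_group_4 bclass_def by (rule presented_group_mult[symmetric])

lemma bclass_inv: "w \<in> bwords \<Longrightarrow> bclass (inv_word w) = inv\<^bsub>braid_group 4\<^esub> bclass w"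
  unfolding braid_group_4 bclass_def by (rule presented_group_inv[symmetric])

lemma bclass_Nil: "bclass [] = \<one>\<^bsub>braid_group 4\<^esub>"
  unfolding braid_group_4 bclass_def by (rule presented_group_one[symmetric])

lemma bclass_eq_iff:
  "u \<in> bwords \<Longrightarrow> v \<in> bwords \<Longrightarrow> bclass u = bclass v \<longleftrightarrow> (u, v) \<in> pres_cong bgens (braid_rels 4)"
  unfolding bclass_def by (rule word_class_eq_iff)

lemma braid_rel_adjacent:
  "1 \<le> i \<Longrightarrow> i + 1 < n \<Longrightarrow> (pos [i, i + 1, i], pos [i + 1, i, i + 1]) \<in> braid_rels n"
  unfolding braid_rels_def by blast

lemma braid_rel_far:
  "1 \<le> i \<Longrightarrow> i + 1 < j \<Longrightarrow> j < n \<Longrightarrow> (pos [i, j], pos [j, i]) \<in> braid_rels n"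
  unfolding braid_rels_def by blast

lemma braid_rels_4: "braid_rels 4 = {(pos [1, 2, 1], pos [2, 1, 2]), (pos [2, 3, 2], pos [3, 2, 3]),
    (pos [1, 3], pos [3, 1])}" (is "_ = ?R")
proof (intro equalityI subsetI)
  fix p assume "p \<in> braid_rels 4"
  then consider i where "p = (pos [i, i + 1, i], pos [i + 1, i, i + 1])" "1 \<le> i" "i + 1 < 4"
    | i j where "p = (pos [i, j], pos [j, i])" "1 \<le> i" "i + 1 < j" "j < 4"
    unfolding braid_rels_def by blast
  then show "p \<in> ?R"
  proof cases
    case (1 i)
    then have "i = 1 \<or> i = 2" by auto
    then show ?thesis using 1(1) by (elim disjE) (simp_all add: numeral_eq_Suc)
  next
    case (2 i j)
    then have "i = 1 \<and> j = 3" by auto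
    then show ?thesis using 2(1) by simp
  qed
next
  fix p assume "p \<in> ?R"
  then show "p \<in> braid_rels 4"
    using braid_rel_adjacent[of 1 4] braid_rel_adjacent[of 2 4] braid_rel_far[of 1 3 4]
    by (auto simp: numeral_eq_Suc)
qed

text \<open>Two generators have a common right multiple, \<open>i j i = j i j\<close> for neighbours
  and \<open>i j = j i\<close> for distant ones. Multiplying such an equation by inverses on both
  sides expresses \<open>i\<^sup>-\<^sup>1 j\<close> as a positive word times the inverse of a
  positive word.\<close>

lemma bclass_reverse:
  assumes "i \<in> bgens" "j \<in> bgens"
  shows "bclass [(i, False), (j, True)] = bclass (rev_pass [(i, False), (j, True)])"
proof -
  let ?v = "rev_pass [(i, False), (j, True)]"
  have v: "?v \<in> bwords" using assms by auto
  have rel: "bclass u = bclass v" if "(u, v) \<in> braid_rels 4" for u v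
  proof -
    have "u \<in> bwords" "v \<in> bwords" using that by (auto simp: braid_rels_4)
    then show ?thesis
      using pres_cong.rel[of "[]" bgens "[]" u v "braid_rels 4"] that by (simp add: bclass_eq_iff)
  qed
  have *: "bclass [(i, False), (j, True)] = bclass ?v"
    if "bclass (pos [j] @ pos js) = bclass (pos [i] @ pos is)"
      "?v = pos is @ inv_word (pos js)" "set is \<subseteq> bgens" "set js \<subseteq> bgens" for "is" js
  proof -
    let ?i = "bclass (pos [i])" and ?j = "bclass (pos [j])"
      and ?p = "bclass (pos is)" and ?q = "bclass (pos js)"
    have c: "?i \<in> carrier (braid_group 4)" "?j \<in> carrier (braid_group 4)"
      "?p \<in> carrier (braid_group 4)" "?q \<in> carrier (braid_group 4)"
      using assms that by simp_all
    have e: "?j \<cdot> ?q = ?i \<cdot> ?p"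
      using that assms by (simp add: bclass_append[symmetric])
    have "inv\<^bsub>braid_group 4\<^esub> ?i \<cdot> ?j
        = inv\<^bsub>braid_group 4\<^esub> ?i \<cdot> (?j \<cdot> ?q)
          \<cdot> inv\<^bsub>braid_group 4\<^esub> ?q"
      using c by (simp add: B.m_assoc)
    also have "\<dots> = ?p \<cdot> inv\<^bsub>braid_group 4\<^esub> ?q"
      unfolding e using c by (simp add: B.m_assoc[symmetric])
    finally have "bclass (inv_word (pos [i]) @ pos [j]) = bclass (pos is @ inv_word (pos js))"
      using that assms
      by (subst (1 2) bclass_append) (auto simp: bclass_inv inv_word_words)
    then show ?thesis unfolding that(2) by (simp add: pos_def)
  qed
  have r: "1 \<le> i" "i < 4" "1 \<le> j" "j < 4" using assms by auto
  consider "i = j" | "i = Suc j" | "j = Suc i" | "Suc i < j" | "Suc j < i" by linarith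
  then show ?thesis
  proof cases
    case 1
    show ?thesis by (rule *[of "[]" "[]"]) (use 1 in \<open>simp_all add: pos_def\<close>)
  next
    case 2
    then have "bclass (pos [j, i, j]) = bclass (pos [i, j, i])"
      using rel[OF braid_rel_adjacent[of j]] r by simp
    then show ?thesis
      by (intro *[of "[i, j]" "[j, i]"]) (use 2 assms in \<open>auto simp: pos_def inv_word_def\<close>)
  next
    case 3
    then have "bclass (pos [i, j, i]) = bclass (pos [j, i, j])"
      using rel[OF braid_rel_adjacent[of i]] r by simp
    then show ?thesis
      by (intro *[of "[i, j]" "[j, i]"]) (use 3 assms in \<open>auto simp: pos_def inv_word_def\<close>)
  next
    case 4
    then have "bclass (pos [i, j]) = bclass (pos [j, i])"
      using rel[OF braid_rel_far[of i j]] r by simp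
    then show ?thesis
      by (intro *[of "[i]" "[j]"]) (use 4 assms in \<open>auto simp: pos_def inv_word_def\<close>)
  next
    case 5
    then have "bclass (pos [j, i]) = bclass (pos [i, j])"
      using rel[OF braid_rel_far[of j i]] r by simp
    then show ?thesis
      by (intro *[of "[i]" "[j]"]) (use 5 assms in \<open>auto simp: pos_def inv_word_def\<close>)
  qed
qed

lemma rev_pass_sound: "w \<in> bwords \<Longrightarrow> rev_pass w \<in> bwords \<and> bclass (rev_pass w) = bclass w"
proof (induction w rule: rev_pass.induct)
  case (1 i j w)
  then have ij: "i \<in> bgens" "j \<in> bgens" and w: "w \<in> bwords" by auto
  have IH: "rev_pass w \<in> bwords" "bclass (rev_pass w) = bclass w"
    using 1 w by (auto split: if_splits)
  have e: "rev_pass ((i, False) # (j, True) # w) = rev_pass [(i, False), (j, True)] @ rev_pass w"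
    by simp
  have v: "rev_pass [(i, False), (j, True)] \<in> bwords" using ij by auto
  have "bclass (rev_pass [(i, False), (j, True)] @ rev_pass w) = bclass ([(i, False), (j, True)] @ w)"
    using bclass_reverse[OF ij] v IH w ij
    by (subst (1 2) bclass_append) simp_all
  then show ?case unfolding e using v IH by simp
next
  case ("2_1" a w)
  then show ?case
    using bclass_append[of "[(a, True)]" w] bclass_append[of "[(a, True)]" "rev_pass w"] by simp
next
  case ("2_2" x)
  then show ?case by simp
next
  case ("2_3" x a w)
  then show ?case
    using bclass_append[of "[x]" "(a, False) # w"]
      bclass_append[of "[x]" "rev_pass ((a, False) # w)"] by simp
qed simp

lemma rev_iter_sound: "w \<in> bwords \<Longrightarrow> rev_iter k w \<in> bwords \<and> bclass (rev_iter k w) = bclass w"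
  by (induction k w rule: rev_iter.induct) (auto simp: Let_def rev_pass_sound)

text \<open>Moving the positive prefix of \<open>v\<close> to its end is a conjugation, and only 1
  is conjugate to 1. This is valid for every \<open>v\<close>, even if the bound 100 stopped the
  reversing early.\<close>

lemma rev_trivial_sound:
  assumes "rev_trivial w" "w \<in> bwords"
  shows "bclass w = \<one>\<^bsub>braid_group 4\<^esub>"
proof -
  define v where "v = rev_iter 100 w"
  have v: "v \<in> bwords" "bclass v = bclass w"
    using rev_iter_sound[OF assms(2)] by (auto simp: v_def)
  let ?p = "takeWhile snd v" and ?m = "dropWhile snd v"
  have pm: "?p \<in> bwords" "?m \<in> bwords"
    using v(1) unfolding words_def by (auto dest: set_takeWhileD set_dropWhileD)
  have "bclass (?m @ ?p) = \<one>\<^bsub>braid_group 4\<^esub>"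
    using rev_iter_sound[of "?m @ ?p" 100] pm assms(1)
    by (simp add: rev_trivial_def v_def Let_def bclass_Nil)
  then have "bclass ?m \<cdot> bclass ?p = \<one>\<^bsub>braid_group 4\<^esub>"
    using pm by (simp add: bclass_append)
  then have "bclass ?p \<cdot> bclass ?m = \<one>\<^bsub>braid_group 4\<^esub>"
    using pm by (metis B.inv_comm bclass_carrier)
  then show ?thesis
    using pm v(2) by (metis bclass_append takeWhile_dropWhile_id)
qed

lemma rev_trivial_eq:
  assumes "rev_trivial (u @ inv_word v)" "u \<in> bwords" "v \<in> bwords"
  shows "bclass u = bclass v"
proof -
  have "bclass (u @ inv_word v) = \<one>\<^bsub>braid_group 4\<^esub>"
    using assms by (intro rev_trivial_sound) (auto simp: inv_word_words)
  then have "bclass u \<cdot> inv\<^bsub>braid_group 4\<^esub> bclass v = \<one>\<^bsub>braid_group 4\<^esub>"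
    using assms by (simp add: bclass_append bclass_inv inv_word_words)
  then show ?thesis
    using assms(2,3) by (metis B.inv_equality B.inv_inv B.inv_closed bclass_carrier)
qed

text \<open>\<open>U\<close> becomes the full twist of the first three strands and \<open>Z\<close>
  that of all four. \<open>Q\<close> is the full twist of the last three strands stripped of two
  squares, which is the braid \<open>3 2 2 3\<^sup>-\<^sup>1\<close> linking strands 2 and 4. The
  inverse in \<open>T\<close> matches the orientation in the relations of
  \<open>qgroup\<close>.\<close>

fun qbraid :: "qgen \<Rightarrow> nat word" where
  "qbraid S = pos [1, 1]"
| "qbraid R = pos [3, 3]"
| "qbraid T = inv_word (pos [2, 2])"
| "qbraid U = pos [1, 2, 1, 2, 1, 2]"
| "qbraid Q = inv_word (pos [2, 2]) @ pos [2, 3, 2, 3, 2, 3] @ inv_word (pos [3, 3])"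
| "qbraid Z = pos [1, 2, 3, 1, 2, 3, 1, 2, 3, 1, 2, 3]"

lemma qbraid_words: "qbraid g \<in> bwords"
  by (cases g) (auto simp: inv_word_words)

text \<open>Strand permutations are represented by their lists of values; \<open>perm_word\<close> is a reduced
  word, obtained by moving the largest value to the end.\<close>

fun perm_word :: "nat \<Rightarrow> nat list \<Rightarrow> nat list" where
  "perm_word 0 l = []"
| "perm_word (Suc n) l =
     perm_word n (remove1 (Suc n) l) @ rev [Suc (length (takeWhile (\<lambda>x. x \<noteq> Suc n) l))..<Suc n]"

definition perms4 :: "nat list list" where
  "perms4 = filter distinct (List.n_lists 4 [1, 2, 3, 4])"

text \<open>The pure braid linking the strands that start at positions \<open>a < b\<close>, counted from 0; the list
  says which strands between them are passed on the left.\<close>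

fun link :: "nat \<Rightarrow> nat \<Rightarrow> bool list \<Rightarrow> qgen word" where
  "link a b l =
    (if a = 0 then
       if b = 1 then [(S, True)]
       else if b = 2 then if hd l then [(S, False), (U, True), (T, True)]
         else [(U, True), (T, True), (S, False)]
       else if l = [False, False] then [(Z, True), (R, False), (Q, False), (U, False)]
       else if l = [False, True] then [(Z, True), (Q, False), (U, False), (R, False)]
       else if l = [True, False] then
         [(S, False), (Z, True), (R, False), (Q, False), (U, False), (S, True)]
       else [(Z, True), (U, False), (R, False), (Q, False)]
     else if a = 1 then
       if b = 2 then [(T, False)]
       else if hd l then [(Q, True)] else [(R, False), (Q, True), (R, True)]
     else [(R, True)])"

text \<open>The Reidemeister--Schreier cocycle of the transversal \<open>perm_word\<close>.\<close>

definition schreier :: "nat \<Rightarrow> nat list \<Rightarrow> qgen word" where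
  "schreier i l =
    (let xs = takeWhile (\<lambda>x. x \<noteq> Suc i) l; ys = dropWhile (\<lambda>x. x \<noteq> Suc i) l;
       zs = takeWhile (\<lambda>x. x \<noteq> i) (tl ys)
     in if i \<in> set xs then []
        else link (length xs) (Suc (length xs + length zs)) (map (\<lambda>x. x < i) zs))"

definition swap_vals :: "nat \<Rightarrow> nat list \<Rightarrow> nat list" where
  "swap_vals i = map (transpose i (i + 1))"

text \<open>If \<open>i\<close> stands before \<open>i + 1\<close> in \<open>l\<close>, prefixing
  \<open>i\<close> to the reduced word gives a reduced word of the swapped permutation, so the
  correction is empty. Otherwise two strands cross twice, and the correction is their link. Three
  generators and 24 cosets make this a finite check by reversing.\<close>

lemma schreier_check:
  "\<forall>i \<in> set [1, 2, 3]. \<forall>l \<in> set perms4.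
     rev_trivial ((pos [i] @ pos (perm_word 4 l)) @
       inv_word (pos (perm_word 4 (swap_vals i l)) @ subst qbraid (schreier i l)))"
  by code_simp

section \<open>The center of the semidirect product\<close>

text \<open>The fibre acts on itself by left multiplication and the base acts by automorphisms. Since
  the action of a fibre word on the empty word returns that word, the free group on the
  fibre generators embeds.\<close>

fun fib_act :: "qgen word \<Rightarrow> qgen word \<Rightarrow> qgen word" where
  "fib_act [] v = v"
| "fib_act (x # w) v =
     (if fst x \<in> base then subst (conj_fib x) (fib_act w v)
      else if fst x = Z then fib_act w v else x # fib_act w v)"

lemma fst_fib: "\<not> (fst x \<in> base) \<Longrightarrow> fst x \<noteq> Z \<Longrightarrow> fst x \<in> fib"
  by (cases "fst x") auto

lemma fib_act_words: "v \<in> words fib \<Longrightarrow> fib_act w v \<in> words fib"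
proof (induction w)
  case (Cons x w)
  have "subst (conj_fib x) (fib_act w v) \<in> words fib"
    by (rule subst_words[OF conj_fib_words Cons.IH[OF Cons.prems]])
  then show ?case using Cons fst_fib[of x] by auto
qed simp

lemma fib_act_append: "fib_act (u @ w) v = fib_act u (fib_act w v)"
  by (induction u) auto

lemma fib_act_fib: "m \<in> words fib \<Longrightarrow> fib_act m v = m @ v"
  by (induction m) auto

lemma fib_act_resp:
  "(v, v') \<in> pres_cong fib {} \<Longrightarrow> (fib_act w v, fib_act w v') \<in> pres_cong fib {}"
proof (induction w)
  case (Cons x w)
  note IH = Cons.IH[OF Cons.prems]
  have "(subst (conj_fib x) (fib_act w v), subst (conj_fib x) (fib_act w v')) \<in> pres_cong fib {}"
    by (rule pres_cong_subst[OF IH conj_fib_words])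
  moreover have "(x # fib_act w v, x # fib_act w v') \<in> pres_cong fib {}" if "fst x \<in> fib"
    using pres_cong_context[OF IH, of "[x]" "[]"] that by simp
  ultimately show ?case using IH fst_fib[of x] by simp
qed simp

lemma subst_conj_fib_cancel:
  assumes "h \<in> base" "w \<in> words fib"
  shows "(subst (conj_fib (h, b)) (subst (conj_fib (h, \<not> b)) w), w) \<in> pres_cong fib {}"
proof -
  have "(subst (conj_fib (h, b)) (conj_fib (h, \<not> b) n), [(n, True)]) \<in> pres_cong fib {}"
    if "n \<in> fib" for n
  proof -
    have "subst (conj_fib (h, b)) (conj_fib (h, \<not> b) n) \<in> words fib"
      by (rule subst_words[OF conj_fib_words conj_fib_words[OF that]])
    from pres_cong_reduce[OF this, of "{}"] show ?thesis
      by (simp only: subst_conj_fib_inverse[OF assms(1) that])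
  qed
  from pres_cong_subst_pointwise[of _ _ "\<lambda>n. [(n, True)]", OF this assms(2)] show ?thesis
    by (simp only: subst_subst subst_id)
qed

text \<open>The action factors through \<open>qgroup\<close>, up to free cancellation in the
  fibre.\<close>

lemma fib_act_cong:
  "(w, w') \<in> pres_cong UNIV qrels \<Longrightarrow> v \<in> words fib \<Longrightarrow>
    (fib_act w v, fib_act w' v) \<in> pres_cong fib {}"
proof (induction rule: pres_cong.induct)
  case (refl w)
  then show ?case by (intro pres_cong.refl fib_act_words)
next
  case (sym u v)
  then show ?case by (auto intro: pres_cong.sym)
next
  case (trans u v w)
  then show ?case by (meson pres_cong.trans)
next
  case (cancel xs ys a b)
  let ?y = "fib_act ys v"
  have y: "?y \<in> words fib" using cancel by (intro fib_act_words)
  have "(fib_act [(a, b), (a, \<not> b)] ?y, ?y) \<in> pres_cong fib {}"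
  proof (cases "a \<in> fib")
    case True
    then show ?thesis using pres_cong.cancel[OF _ y True, of "[]" b] by auto
  next
    case False
    then show ?thesis
      using subst_conj_fib_cancel[OF _ y, of a b] fst_fib[of "(a, b)"] pres_cong.refl[OF y] by auto
  qed
  then show ?case
    unfolding fib_act_append by (rule fib_act_resp)
next
  case (rel xs ys u u')
  let ?y = "fib_act ys v"
  have y: "?y \<in> words fib" using rel by (intro fib_act_words)
  \<comment> \<open>Both sides of a conjugation relation act by literally the same word, since
    substitution distributes over concatenation; \<open>Z\<close> acts as the identity.\<close>
  have "fib_act u ?y = fib_act u' ?y"
    using rel(5) by (auto simp: qrels_def fib_act_append)
  then show ?case
    unfolding fib_act_append using y by (auto intro!: pres_cong.refl fib_act_words)
qed

section \<open>Projection of the semidirect product onto its base\<close>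

definition base_part :: "qgen word \<Rightarrow> qgen word" where
  "base_part w = filter (\<lambda>x. fst x \<in> base) w"

lemma base_part_simps [simp]:
  "base_part [] = []"
  "base_part (x # w) = (if fst x \<in> base then x # base_part w else base_part w)"
  "base_part (u @ v) = base_part u @ base_part v"
  by (auto simp: base_part_def)

lemma base_part_words: "base_part w \<in> words base"
  by (induction w) auto

text \<open>Deleting all letters outside the base makes the two sides of every defining relation
  identical words, so only free cancellation remains.\<close>

lemma base_part_cong:
  "(w, w') \<in> pres_cong UNIV qrels \<Longrightarrow> (base_part w, base_part w') \<in> pres_cong base {}"
proof (induction rule: pres_cong.induct)
  case (refl w)
  then show ?case by (intro pres_cong.refl base_part_words)
next
  case (trans u v w)
  then show ?case by (meson pres_cong.trans)
next
  case (cancel xs ys a b)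
  then show ?case
    using pres_cong.cancel[OF base_part_words base_part_words, of a xs b ys "{}"]
    by (cases "a \<in> base") (auto intro!: pres_cong.refl simp: base_part_words)
next
  case (rel xs ys u u')
  have "base_part u = base_part u'"
    using rel(5) by (auto simp: qrels_def)
  then show ?case by (auto intro!: pres_cong.refl simp: base_part_words)
qed (auto intro: pres_cong.sym)

lemma snd_nf: "snd (nf w) = reduce (base_part w)"
  by (induction w) (auto simp: nf_step_def split: prod.splits)

text \<open>A central element projects to a central, hence trivial, element of the free group on the
  base. It therefore lies in the fibre, where it commutes with the free generators and is trivial
  for the same reason.\<close>

lemma qgroup_center_trivial:
  assumes "x \<in> carrier qgroup"
    and comm: "\<And>y. y \<in> carrier qgroup \<Longrightarrow> x \<otimes>\<^bsub>qgroup\<^esub> y = y \<otimes>\<^bsub>qgroup\<^esub> x"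
  shows "x = \<one>\<^bsub>qgroup\<^esub>"
proof -
  obtain w where w: "x = qclass w"
    using assms(1) unfolding qgroup_def by (rule presented_group_carrierE)
  have "qclass (w @ [(g, True)]) = qclass ((g, True) # w)" for g
    using comm[of "qclass [(g, True)]"] by (simp add: w qclass_append[symmetric])
  then have cw: "(w @ [(g, True)], (g, True) # w) \<in> pres_cong UNIV qrels" for g
    by (simp only: qclass_eq_iff)
  have "reduce (base_part w) = []"
  proof (rule free_group_center_trivial[where S = base and a = S and b = T])
    fix g assume "g \<in> base"
    then show "(base_part w @ [(g, True)], (g, True) # base_part w) \<in> pres_cong base {}"
      using base_part_cong[OF cw[of g]] by (auto split: if_splits)
  qed (use base_part_words[of w] in auto)
  then obtain n where n: "nf w = (n, [])"
    using snd_nf[of w] by (cases "nf w") auto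
  then have n_words: "n \<in> words fib" and x: "x = qclass n"
    using nf_sound[of w] w by auto
  have "reduce n = []"
  proof (rule free_group_center_trivial[where S = fib and a = U and b = Q])
    fix g assume g: "g \<in> fib"
    have "qclass (n @ [(g, True)]) = qclass ((g, True) # n)"
      using comm[of "qclass [(g, True)]"] by (simp add: x qclass_append[symmetric])
    then have "(n @ [(g, True)], (g, True) # n) \<in> pres_cong UNIV qrels"
      by (simp only: qclass_eq_iff)
    moreover have "n @ [(g, True)] \<in> words fib" "(g, True) # n \<in> words fib"
      using g n_words by auto
    \<comment> \<open>Acting on the empty word returns a fibre word unchanged, so congruence in
      \<open>qgroup\<close> descends to free congruence.\<close>
    ultimately show "(n @ [(g, True)], (g, True) # n) \<in> pres_cong fib {}"
      using fib_act_cong[of "n @ [(g, True)]" "(g, True) # n" "[]"]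
      by (simp only: fib_act_fib append_Nil2 words_simps(1) simp_thms)
  qed (use n_words in auto)
  then show ?thesis
    using qclass_reduce[of n] by (simp add: x qclass_Nil)
qed

section \<open>The pure braid group modulo its center\<close>

fun track :: "nat word \<Rightarrow> nat list \<Rightarrow> nat list" where
  "track [] l = l"
| "track (x # w) l = swap_vals (fst x) (track w l)"

text \<open>Words act from the left, so \<open>track w l\<close> is the coset at which the next
  letter is read. An inverse letter leads to the swapped coset, and the correction of the positive
  letter starting there is inverted.\<close>

fun cocycle :: "nat word \<Rightarrow> nat list \<Rightarrow> qgen word" where
  "cocycle [] l = []"
| "cocycle ((i, b) # w) l =
     (if b then schreier i (track w l) else inv_word (schreier i (swap_vals i (track w l))))
     @ cocycle w l"

lemma track_append: "track (u @ v) l = track u (track v l)"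
  by (induction u) auto

lemma cocycle_append: "cocycle (u @ v) l = cocycle u (track v l) @ cocycle v l"
  by (induction u) (auto simp: track_append)

lemma swap_vals_swap_vals [simp]: "swap_vals i (swap_vals i l) = l"
  by (simp add: swap_vals_def)

lemma set_perms4: "l \<in> set perms4 \<longleftrightarrow> length l = 4 \<and> distinct l \<and> set l \<subseteq> {1, 2, 3, 4}"
  by (auto simp: perms4_def set_n_lists)

lemma swap_vals_perms4:
  assumes "i \<in> bgens" "l \<in> set perms4"
  shows "swap_vals i l \<in> set perms4"
proof -
  have "distinct (swap_vals i l)"
    using assms(2) by (auto simp: swap_vals_def set_perms4 distinct_map)
  moreover have "transpose i (i + 1) x \<in> {1, 2, 3, 4}" if "x \<in> {1, 2, 3, 4}" for x
    using assms(1) that by (auto simp: transpose_def)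
  ultimately show ?thesis
    using assms(2) by (auto simp: swap_vals_def set_perms4)
qed

lemma track_perms4: "w \<in> bwords \<Longrightarrow> l \<in> set perms4 \<Longrightarrow> track w l \<in> set perms4"
proof (induction w)
  case (Cons x w)
  then show ?case using swap_vals_perms4[of "fst x" "track w l"] by simp
qed simp

lemma cocycle_check:
  "\<forall>(u, v) \<in> set [(pos [1, 2, 1], pos [2, 1, 2]), (pos [2, 3, 2], pos [3, 2, 3]),
      (pos [1, 3], pos [3, 1])].
    \<forall>l \<in> set perms4. track u l = track v l \<and> nf (cocycle u l) = nf (cocycle v l)"
  by code_simp

text \<open>The corrections of the outer parts depend only on the cosets at which they are read.
  Hence only the piece where the relation is applied matters, and there the finite check gives equal
  cosets and equal normal forms.\<close>

lemma cocycle_cong: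
  "(u, v) \<in> pres_cong bgens (braid_rels 4) \<Longrightarrow> l \<in> set perms4 \<Longrightarrow>
    track u l = track v l \<and> qclass (cocycle u l) = qclass (cocycle v l)"
proof (induction rule: pres_cong.induct)
  case (sym u v)
  then show ?case by (metis (no_types, lifting))
next
  case (trans u v w)
  then show ?case by (metis (no_types, lifting))
next
  case (cancel xs ys a b)
  let ?l = "track ys l"
  have "qclass (cocycle [(a, b), (a, \<not> b)] ?l) = qclass []"
    unfolding qclass_eq_iff
    using pres_cong_inverse[of "schreier a ?l" UNIV qrels]
      pres_cong_inverse[of "schreier a (swap_vals a ?l)" UNIV qrels]
    by (cases b) auto
  then have "qclass (cocycle xs ?l @ cocycle [(a, b), (a, \<not> b)] ?l @ cocycle ys l)
      = qclass (cocycle xs ?l @ [] @ cocycle ys l)"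
    by (simp only: qclass_append)
  moreover have "track [(a, b), (a, \<not> b)] ?l = ?l" by simp
  ultimately show ?case by (simp only: cocycle_append track_append append_Nil)
next
  case (rel xs ys u v)
  let ?l = "track ys l"
  have "?l \<in> set perms4" using rel by (intro track_perms4)
  then have t: "track u ?l = track v ?l" and "nf (cocycle u ?l) = nf (cocycle v ?l)"
    using cocycle_check rel(5) unfolding braid_rels_4 by auto
  then have "qclass (cocycle u ?l) = qclass (cocycle v ?l)" by (intro nf_eq_imp)
  then show ?case by (simp only: cocycle_append track_append qclass_append t)
qed simp

lemma perm_word_words: "set (perm_word n l) \<subseteq> {1..<n}"
proof (induction n l rule: perm_word.induct)
  case (2 n l)
  have "{1..<n} \<subseteq> {1..<Suc n}" by auto
  with 2 have "set (perm_word n (remove1 (Suc n) l)) \<subseteq> {1..<Suc n}" by blast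
  then show ?case by auto
qed simp

lemma perm_word_bgens [simp]: "set (perm_word 4 l) \<subseteq> bgens"
  using perm_word_words[of 4 l] by (simp only: bgens_def)

lemma subst_qbraid_words [simp]: "subst qbraid k \<in> bwords"
  by (rule subst_words[OF qbraid_words words_UNIV])

lemma schreier_braid:
  assumes "i \<in> bgens" "l \<in> set perms4"
  shows "bclass ((i, True) # pos (perm_word 4 l))
    = bclass (pos (perm_word 4 (swap_vals i l)) @ subst qbraid (schreier i l))"
proof (rule rev_trivial_eq)
  have "i \<in> set [1, 2, 3]" using assms(1) by auto
  then have "rev_trivial ((pos [i] @ pos (perm_word 4 l)) @
       inv_word (pos (perm_word 4 (swap_vals i l)) @ subst qbraid (schreier i l)))"
    using schreier_check assms(2) by blast
  then show "rev_trivial (((i, True) # pos (perm_word 4 l)) @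
       inv_word (pos (perm_word 4 (swap_vals i l)) @ subst qbraid (schreier i l)))"
    by (simp add: pos_def)
qed (use assms in simp_all)

lemma subst_inv_word: "subst \<phi> (inv_word w) = inv_word (subst \<phi> w)"
  by (induction w) (auto simp: inv_word_def rev_map comp_def case_prod_beta)

text \<open>The Reidemeister--Schreier rewriting: each letter of \<open>w\<close>, taken from the
  right, turns the coset representative into the next one and leaves its correction to the right of
  it.\<close>

lemma bclass_cocycle:
  assumes "w \<in> bwords" "l \<in> set perms4"
  shows "bclass (w @ pos (perm_word 4 l))
    = bclass (pos (perm_word 4 (track w l)) @ subst qbraid (cocycle w l))"
  using assms(1)
proof (induction w)
  case (Cons x w)
  obtain i b where x: "x = (i, b)" by force
  then have i: "i \<in> bgens" and w: "w \<in> bwords" using Cons.prems by auto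
  let ?l = "track w l"
  let ?r = "\<lambda>l. pos (perm_word 4 l)"
  have l: "?l \<in> set perms4" using w assms(2) by (rule track_perms4)
  have step: "bclass ([x] @ ?r ?l) = bclass (?r (swap_vals i ?l) @ subst qbraid (cocycle [x] ?l))"
  proof (cases b)
    case True
    then show ?thesis using schreier_braid[OF i l] x by simp
  next
    case False
    \<comment> \<open>The relation for \<open>i\<close> at the swapped coset leads back to
      \<open>?l\<close>; it is solved for the inverse letter.\<close>
    let ?l' = "swap_vals i ?l" and ?c = "subst qbraid (schreier i (swap_vals i ?l))"
    let ?i = "bclass [(i, True)]"
    have "bclass ([(i, True)] @ ?r ?l') = bclass (?r ?l @ ?c)"
      using schreier_braid[OF i swap_vals_perms4[OF i l]] by simp
    then have e: "?i \<cdot> bclass (?r ?l') = bclass (?r ?l) \<cdot> bclass ?c"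
      using i by (simp add: bclass_append del: append.simps)
    have c: "?i \<in> carrier (braid_group 4)" using i by simp
    have "inv\<^bsub>braid_group 4\<^esub> ?i \<cdot> bclass (?r ?l)
        = inv\<^bsub>braid_group 4\<^esub> ?i \<cdot> (bclass (?r ?l) \<cdot> bclass ?c) \<cdot> inv\<^bsub>braid_group 4\<^esub> bclass ?c"
      using c by (simp add: B.m_assoc)
    also have "\<dots> = bclass (?r ?l') \<cdot> inv\<^bsub>braid_group 4\<^esub> bclass ?c"
      unfolding e[symmetric] using c by (simp add: B.m_assoc[symmetric])
    finally have "bclass (inv_word [(i, True)] @ ?r ?l) = bclass (?r ?l' @ inv_word ?c)"
      using i by (simp add: bclass_append bclass_inv inv_word_words del: append.simps inv_word_single)
    then show ?thesis using False x by (simp add: subst_inv_word)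
  qed
  have xw: "[x] \<in> bwords" using x i by simp
  have "bclass ((x # w) @ ?r l) = bclass [x] \<cdot> bclass (w @ ?r l)"
    using bclass_append[OF xw, of "w @ ?r l"] w by simp
  also have "\<dots> = bclass [x] \<cdot> (bclass (?r ?l) \<cdot> bclass (subst qbraid (cocycle w l)))"
    using Cons.IH w by (simp add: bclass_append)
  also have "\<dots> = bclass ([x] @ ?r ?l) \<cdot> bclass (subst qbraid (cocycle w l))"
    by (simp add: bclass_append[OF xw] B.m_assoc[OF bclass_carrier[OF xw]] del: append.simps)
  also have "\<dots> = bclass (?r (swap_vals i ?l)) \<cdot> (bclass (subst qbraid (cocycle [x] ?l))
      \<cdot> bclass (subst qbraid (cocycle w l)))"
    unfolding step by (simp add: bclass_append B.m_assoc)
  also have "\<dots> = bclass (?r (track (x # w) l) @ subst qbraid (cocycle (x # w) l))"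
    using x by (simp add: bclass_append)
  finally show ?case .
qed simp

section \<open>Pure braids among braid words\<close>

definition id4 :: "nat list" where
  "id4 = [1, 2, 3, 4]"

lemma id4_perms4: "id4 \<in> set perms4"
  by (simp add: id4_def set_perms4)

lemma braid_perm_bclass:
  assumes "w \<in> bwords"
  shows "braid_perm 4 (bclass w) = word_eval (sym_group 4) (\<lambda>i. transpose i (i + 1)) w"
  unfolding braid_perm_def bclass_def
proof (rule group.pres_lift_class[OF sym_group_is_group])
  show "(\<lambda>i. transpose i (i + 1)) \<in> bgens \<rightarrow> carrier (sym_group 4)"
    by (auto simp: sym_group_def bgens_def intro!: permutes_swap_id)
  fix u v :: "nat word" assume "(u, v) \<in> braid_rels 4"
  then show "word_eval (sym_group 4) (\<lambda>i. transpose i (i + 1)) u =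
             word_eval (sym_group 4) (\<lambda>i. transpose i (i + 1)) v"
    by (auto simp: braid_rels_def pos_def sym_group_def fun_eq_iff transpose_def)
qed (rule assms)

lemma track_word_eval:
  assumes "w \<in> bwords"
  shows "track w l = map (word_eval (sym_group 4) (\<lambda>i. transpose i (i + 1)) w) l"
  using assms
proof (induction w)
  case Nil
  then show ?case by (simp add: sym_group_def)
next
  case (Cons x w)
  obtain i b where x: "x = (i, b)" by force
  have t: "transpose i (i + 1) \<in> carrier (sym_group 4)"
    using Cons.prems x by (auto simp: sym_group_def bgens_def intro!: permutes_swap_id)
  have "inv\<^bsub>sym_group 4\<^esub> transpose i (i + 1) = transpose i (i + 1)"
    by (rule group.inv_equality[OF sym_group_is_group _ t t]) (simp add: sym_group_def)
  then show ?case
    using Cons x by (simp add: swap_vals_def sym_group_def)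
qed

lemma bclass_pure_iff:
  assumes "w \<in> bwords"
  shows "bclass w \<in> carrier (pure_braid_group 4) \<longleftrightarrow> track w id4 = id4"
proof -
  let ?p = "word_eval (sym_group 4) (\<lambda>i. transpose i (i + 1)) w"
  have "?p \<in> carrier (sym_group 4)"
    by (rule group.word_eval_closed[OF sym_group_is_group _ assms])
      (auto simp: sym_group_def bgens_def intro!: permutes_swap_id)
  then have p: "?p permutes {1..4}" by (simp add: sym_group_def)
  have "bclass w \<in> carrier (pure_braid_group 4) \<longleftrightarrow> ?p = id"
    using assms by (simp add: pure_braid_group_def kernel_def braid_perm_bclass sym_group_def)
  \<comment> \<open>Outside \<open>{1..4}\<close> the permutation is the identity anyway, so the
    list \<open>id4\<close> detects it.\<close>
  also have "\<dots> \<longleftrightarrow> (\<forall>x\<in>{1..4}. ?p x = x)"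
    using p by (auto simp: permutes_def fun_eq_iff)
  also have "{1..4} = set id4" by (auto simp: id4_def)
  also have "(\<forall>x\<in>set id4. ?p x = x) \<longleftrightarrow> track w id4 = id4"
    by (simp add: track_word_eval[OF assms] map_idI list_eq_iff_nth_eq all_set_conv_all_nth)
  finally show ?thesis .
qed

lemma pure_carrierE:
  assumes "x \<in> carrier (pure_braid_group 4)"
  obtains w where "w \<in> bwords" "x = bclass w" "track w id4 = id4"
proof -
  have "x \<in> carrier (presented_group bgens (braid_rels 4))"
    using assms by (simp add: pure_braid_group_def kernel_def braid_group_4)
  then obtain w where "w \<in> bwords" "x = bclass w"
    unfolding bclass_def by (rule presented_group_carrierE)
  then show ?thesis using that assms bclass_pure_iff by blast
qed

text \<open>The first conjunct makes the chosen braids pure; the second will show that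
  \<open>rho\<close> sends each of them back to its generator, which makes \<open>rho\<close>
  surjective.\<close>

lemma qbraid_check:
  "\<forall>g \<in> set [U, Q, R, S, T, Z]. track (qbraid g) id4 = id4 \<and>
     nf (cocycle (qbraid g) id4) = nf [(g, True)]"
  by code_simp

text \<open>The conjugation relations hold between the braids themselves; passing to the quotient by
  the center serves the relation for \<open>Z\<close>.\<close>

lemma qbraid_rels_check:
  "\<forall>h \<in> set [S, T]. \<forall>n \<in> set [U, Q, R].
     rev_trivial (subst qbraid [(h, True), (n, True)] @
       inv_word (subst qbraid (conj_fib (h, True) n @ [(h, True)])))"
  by code_simp

lemma qbraid_Z_check:
  "\<forall>i \<in> set [1, 2, 3]. rev_trivial ((qbraid Z @ [(i, True)]) @ inv_word ([(i, True)] @ qbraid Z))"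
  by code_simp

lemma qgen_set: "g \<in> set [U, Q, R, S, T, Z]"
  by (cases g) auto

interpretation P: group "pure_braid_group 4"
  by (rule group_pure_braid_group)

lemma pure_mult [simp]: "x \<otimes>\<^bsub>pure_braid_group 4\<^esub> y = x \<cdot> y"
  by (simp add: pure_braid_group_def)

lemma qbraid_pure: "bclass (qbraid g) \<in> carrier (pure_braid_group 4)"
  using qbraid_check qgen_set[of g] by (simp only: bclass_pure_iff qbraid_words)

lemma word_eval_qbraid: "word_eval (pure_braid_group 4) (\<lambda>g. bclass (qbraid g)) k = bclass (subst qbraid k)"
proof -
  have gen: "(\<lambda>a. bclass [(a, True)]) \<in> bgens \<rightarrow> carrier (braid_group 4)" by simp
  have ev: "word_eval (braid_group 4) (\<lambda>a. bclass [(a, True)]) w = bclass w" if "w \<in> bwords" for w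
    using that unfolding braid_group_4 bclass_def by (rule word_eval_classes)
  have "(\<lambda>x. x) \<in> hom (pure_braid_group 4) (braid_group 4)"
    by (auto simp: hom_def pure_braid_group_def kernel_def)
  from hom_word_eval[OF P.is_group B.is_group this, of "\<lambda>g. bclass (qbraid g)" UNIV k]
  have "word_eval (pure_braid_group 4) (\<lambda>g. bclass (qbraid g)) k
      = word_eval (braid_group 4) (\<lambda>g. bclass (qbraid g)) k"
    using qbraid_pure by auto
  also have "\<dots> = word_eval (braid_group 4) (\<lambda>a. bclass [(a, True)]) (subst qbraid k)"
    using B.word_eval_subst[OF gen, of UNIV qbraid k] qbraid_words by (simp add: ev)
  finally show ?thesis by (simp add: ev)
qed

text \<open>The representative of the identity coset is the empty word. Hence every pure braid is a
  product of the braids \<open>qbraid g\<close> and their inverses, spelled out by its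
  cocycle.\<close>

lemma bclass_pure_cocycle:
  assumes "w \<in> bwords" "track w id4 = id4"
  shows "bclass w = bclass (subst qbraid (cocycle w id4))"
proof -
  have "perm_word 4 id4 = []" by (simp add: id4_def numeral_eq_Suc)
  then show ?thesis
    using bclass_cocycle[OF assms(1) id4_perms4] assms(2) by (simp add: pos_def)
qed

lemma qbraid_Z_center: "bclass (qbraid Z) \<in> center (pure_braid_group 4)"
proof -
  have "bclass (qbraid Z) \<cdot> bclass [(i, True)] = bclass [(i, True)] \<cdot> bclass (qbraid Z)"
    if "i \<in> bgens" for i
  proof -
    have "rev_trivial ((qbraid Z @ [(i, True)]) @ inv_word ([(i, True)] @ qbraid Z))"
      using qbraid_Z_check that by auto
    from rev_trivial_eq[OF this] show ?thesis
      using that qbraid_words[of Z] by (simp add: bclass_append del: append.simps qbraid.simps)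
  qed
  then have *: "bclass (qbraid Z) \<cdot> word_eval (braid_group 4) (\<lambda>a. bclass [(a, True)]) w
      = word_eval (braid_group 4) (\<lambda>a. bclass [(a, True)]) w \<cdot> bclass (qbraid Z)" if "w \<in> bwords" for w
    by (intro B.word_eval_commute[OF _ _ _ that]) (auto simp: qbraid_words simp del: qbraid.simps)
  have "bclass (qbraid Z) \<cdot> bclass w = bclass w \<cdot> bclass (qbraid Z)" if "w \<in> bwords" for w
    using *[OF that] that unfolding bclass_def braid_group_4 by (simp only: word_eval_classes)
  then show ?thesis
    using qbraid_pure by (auto simp: center_def simp del: qbraid.simps elim!: pure_carrierE)
qed

section \<open>The homomorphism from the pure braid group onto the semidirect product\<close>

definition rho :: "nat word set \<Rightarrow> qgen word set" where
  "rho x = qclass (cocycle (SOME w. w \<in> bwords \<and> x = bclass w) id4)"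

lemma rho_bclass:
  assumes "w \<in> bwords"
  shows "rho (bclass w) = qclass (cocycle w id4)"
proof -
  let ?v = "SOME v. v \<in> bwords \<and> bclass w = bclass v"
  have "?v \<in> bwords \<and> bclass w = bclass ?v"
    by (rule someI[of _ w]) (use assms in simp)
  then have "(?v, w) \<in> pres_cong bgens (braid_rels 4)"
    using assms by (simp only: bclass_eq_iff[symmetric])
  then show ?thesis
    using cocycle_cong[OF _ id4_perms4] unfolding rho_def by blast
qed

text \<open>The right factor of a product of pure braids returns to the identity coset, so the left
  factor is read from there as well.\<close>

lemma rho_hom: "rho \<in> hom (pure_braid_group 4) qgroup"
proof (rule homI)
  fix x assume "x \<in> carrier (pure_braid_group 4)"
  then obtain u where u: "u \<in> bwords" "x = bclass u" "track u id4 = id4" by (rule pure_carrierE)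
  show "rho x \<in> carrier qgroup" using u by (simp add: rho_bclass)
  fix y assume "y \<in> carrier (pure_braid_group 4)"
  then obtain v where v: "v \<in> bwords" "y = bclass v" "track v id4 = id4" by (rule pure_carrierE)
  have "rho (bclass (u @ v)) = rho (bclass u) \<otimes>\<^bsub>qgroup\<^esub> rho (bclass v)"
    using u v by (simp add: rho_bclass cocycle_append qclass_append)
  then show "rho (x \<otimes>\<^bsub>pure_braid_group 4\<^esub> y) = rho x \<otimes>\<^bsub>qgroup\<^esub> rho y"
    using u v by (simp add: bclass_append)
qed

lemma rho_qbraid: "rho (bclass (subst qbraid k)) = qclass k"
proof -
  have "nf (cocycle (qbraid g) id4) = nf [(g, True)]" for g
    using bspec[OF qbraid_check qgen_set] by (rule conjunct2)
  then have g: "rho (bclass (qbraid g)) = qclass [(g, True)]" for g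
    unfolding rho_bclass[OF qbraid_words] by (rule nf_eq_imp)
  have "rho (bclass (subst qbraid k)) = word_eval qgroup (\<lambda>g. qclass [(g, True)]) k"
    using hom_word_eval[OF P.is_group Q.is_group rho_hom, of "\<lambda>g. bclass (qbraid g)" UNIV k] qbraid_pure
    by (simp add: word_eval_qbraid g)
  then show ?thesis
    unfolding qgroup_def by (simp only: word_eval_classes words_UNIV)
qed

lemma subst_qbraid_pure: "bclass (subst qbraid k) \<in> carrier (pure_braid_group 4)"
  unfolding word_eval_qbraid[symmetric]
  by (rule P.word_eval_closed[of _ UNIV]) (auto simp: qbraid_pure)

lemma rho_surj: "rho ` carrier (pure_braid_group 4) = carrier qgroup"
proof
  show "rho ` carrier (pure_braid_group 4) \<subseteq> carrier qgroup"
    using rho_hom by (auto simp: hom_def)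
  show "carrier qgroup \<subseteq> rho ` carrier (pure_braid_group 4)"
  proof
    fix x assume "x \<in> carrier qgroup"
    then obtain k where "x = qclass k"
      unfolding qgroup_def by (rule presented_group_carrierE)
    then show "x \<in> rho ` carrier (pure_braid_group 4)"
      using rho_qbraid[of k] subst_qbraid_pure[of k] by (intro image_eqI[of _ _ "bclass (subst qbraid k)"]) simp_all
  qed
qed

text \<open>The relations of \<open>qgroup\<close> hold modulo the center, which gives a homomorphism back
  from \<open>qgroup\<close> undoing \<open>rho\<close> modulo the center.\<close>

lemma kernel_rho: "kernel (pure_braid_group 4) qgroup rho = center (pure_braid_group 4)"
proof
  let ?P = "pure_braid_group 4"
  let ?C = "center ?P"
  interpret C: normal ?C ?P by (rule P.center_normal)
  let ?f = "\<lambda>g. ?C #>\<^bsub>?P\<^esub> bclass (qbraid g)"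
  have M: "group (?P Mod ?C)" by (rule C.factorgroup_is_group)
  have can: "(\<lambda>x. ?C #>\<^bsub>?P\<^esub> x) \<in> hom ?P (?P Mod ?C)" by (rule C.r_coset_hom_Mod)
  have f: "?f \<in> UNIV \<rightarrow> carrier (?P Mod ?C)"
    using can qbraid_pure by (auto simp: hom_def)
  have ev: "word_eval (?P Mod ?C) ?f k = ?C #>\<^bsub>?P\<^esub> bclass (subst qbraid k)" for k
    using hom_word_eval[OF P.is_group M can, of "\<lambda>g. bclass (qbraid g)" UNIV k] qbraid_pure
    by (simp add: word_eval_qbraid)
  have one: "\<one>\<^bsub>?P Mod ?C\<^esub> = ?C" by (simp add: FactGroup_def)
  have rels: "word_eval (?P Mod ?C) ?f u = word_eval (?P Mod ?C) ?f v" if uv_rel: "(u, v) \<in> qrels" for u v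
  proof (cases "(u, v) = ([(Z, True)], [])")
    case True
    have "?C #>\<^bsub>?P\<^esub> bclass (qbraid Z) = ?C"
      by (rule P.coset_join2[OF qbraid_pure C.is_subgroup qbraid_Z_center])
    then show ?thesis
      using True ev[of u] by (simp add: one del: qbraid.simps)
  next
    case False
    then obtain h n where "h \<in> set [S, T]" "n \<in> set [U, Q, R]"
      and uv: "u = [(h, True), (n, True)]" "v = conj_fib (h, True) n @ [(h, True)]"
      using uv_rel unfolding qrels_def by auto
    then have "rev_trivial (subst qbraid u @ inv_word (subst qbraid v))"
      using qbraid_rels_check by blast
    then have "bclass (subst qbraid u) = bclass (subst qbraid v)"
      by (intro rev_trivial_eq) auto
    then show ?thesis unfolding ev by simp
  qed
  show "kernel ?P qgroup rho \<subseteq> ?C"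
  proof
    fix x assume x: "x \<in> kernel ?P qgroup rho"
    then have xP: "x \<in> carrier ?P" by (simp add: kernel_def)
    then obtain w where w: "w \<in> bwords" "x = bclass w" "track w id4 = id4"
      by (rule pure_carrierE)
    let ?k = "cocycle w id4"
    have "qclass ?k = qclass []"
      using x w by (simp add: kernel_def rho_bclass qclass_Nil)
    then have "(?k, []) \<in> pres_cong UNIV qrels" by (simp only: qclass_eq_iff)
    \<comment> \<open>The word \<open>?k\<close> is trivial in \<open>qgroup\<close>, hence also in
      the quotient by the center, where all relations hold; and there it evaluates to the coset of
      \<open>x\<close>.\<close>
    then have "word_eval (?P Mod ?C) ?f ?k = word_eval (?P Mod ?C) ?f []"
      using group.word_eval_cong[OF M f rels] by blast
    then have "?C #>\<^bsub>?P\<^esub> x = ?C"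
      using bclass_pure_cocycle[OF w(1,3)] w(2) by (simp add: ev one)
    then show "x \<in> ?C"
      using P.coset_join1[OF _ xP C.is_subgroup] by simp
  qed
  show "?C \<subseteq> kernel ?P qgroup rho"
  proof
    fix z assume "z \<in> ?C"
    then have z: "z \<in> carrier ?P" "\<And>x. x \<in> carrier ?P \<Longrightarrow> z \<otimes>\<^bsub>?P\<^esub> x = x \<otimes>\<^bsub>?P\<^esub> z"
      unfolding center_def by blast+
    \<comment> \<open>A surjection maps central elements to central ones, and the center of
      \<open>qgroup\<close> is trivial.\<close>
    have "rho z = \<one>\<^bsub>qgroup\<^esub>"
    proof (rule qgroup_center_trivial)
      show "rho z \<in> carrier qgroup" using z rho_hom by (auto simp: hom_def)
      fix y assume "y \<in> carrier qgroup"
      then obtain x where x: "x \<in> carrier ?P" "y = rho x" using rho_surj by blast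
      have "rho z \<otimes>\<^bsub>qgroup\<^esub> rho x = rho (z \<otimes>\<^bsub>?P\<^esub> x)"
        by (rule hom_mult[OF rho_hom z(1) x(1), symmetric])
      also have "\<dots> = rho x \<otimes>\<^bsub>qgroup\<^esub> rho z"
        unfolding z(2)[OF x(1)] by (rule hom_mult[OF rho_hom x(1) z(1)])
      finally show "rho z \<otimes>\<^bsub>qgroup\<^esub> y = y \<otimes>\<^bsub>qgroup\<^esub> rho z" using x by simp
    qed
    then show "z \<in> kernel ?P qgroup rho" using z by (simp add: kernel_def)
  qed
qed

lemma pure_braid_group_mod_center_iso: "pure_braid_group_mod_center 4 \<cong> qgroup"
proof -
  interpret group_hom "pure_braid_group 4" qgroup rho
    by (intro group_hom.intro group_hom_axioms.intro rho_hom P.is_group Q.is_group)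
  show ?thesis
    using FactGroup_iso[OF rho_surj] unfolding kernel_rho pure_braid_group_mod_center_def .
qed

section \<open>The pure virtual braid group as a free product\<close>

lemma vP3_rels_eq: "vP3_rels =
  {(pos [(1, 2), (1, 3), (2, 3)], pos [(2, 3), (1, 3), (1, 2)]),
   (pos [(1, 3), (1, 2), (3, 2)], pos [(3, 2), (1, 2), (1, 3)]),
   (pos [(2, 1), (2, 3), (1, 3)], pos [(1, 3), (2, 3), (2, 1)]),
   (pos [(2, 3), (2, 1), (3, 1)], pos [(3, 1), (2, 1), (2, 3)]),
   (pos [(3, 1), (3, 2), (1, 2)], pos [(1, 2), (3, 2), (3, 1)]),
   (pos [(3, 2), (3, 1), (2, 1)], pos [(2, 1), (3, 1), (3, 2)])}" (is "_ = ?rels")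
proof (intro equalityI subsetI)
  fix p assume "p \<in> vP3_rels"
  then obtain i j k where p: "p = (pos [(i, j), (i, k), (j, k)], pos [(j, k), (i, k), (i, j)])"
    and ijk: "i \<in> {1..3}" "j \<in> {1..3}" "k \<in> {1..3}" "i \<noteq> j" "j \<noteq> k" "i \<noteq> k"
    unfolding vP3_rels_def by blast
  have "i = 1 \<or> i = 2 \<or> i = 3" "j = 1 \<or> j = 2 \<or> j = 3" "k = 1 \<or> k = 2 \<or> k = 3"
    using ijk(1-3) by auto
  then have "(i, j, k) \<in> {(1, 2, 3), (1, 3, 2), (2, 1, 3), (2, 3, 1), (3, 1, 2), (3, 2, 1)}"
    using ijk(4-6) by (elim disjE) simp_all
  then show "p \<in> ?rels" unfolding p by (elim insertE emptyE) simp_all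
next
  fix p assume p: "p \<in> ?rels"
  have mem: "(pos [(i, j), (i, k), (j, k)], pos [(j, k), (i, k), (i, j)]) \<in> vP3_rels"
    if "i \<in> {1..3}" "j \<in> {1..3}" "k \<in> {1..3}" "i \<noteq> j" "j \<noteq> k" "i \<noteq> k" for i j k
    unfolding vP3_rels_def using that by blast
  show "p \<in> vP3_rels"
    using p by (elim insertE emptyE; simp only:; intro mem; simp)
qed

lemma vP3_gens_eq: "vP3_gens = {(1, 2), (1, 3), (2, 3), (2, 1), (3, 1), (3, 2)}"
proof -
  have "{1..3 :: nat} = {1, 2, 3}" by auto
  then show ?thesis unfolding vP3_gens_def by auto
qed

definition xgen :: "nat \<times> nat \<Rightarrow> (nat \<times> nat) word set" where
  "xgen p = word_class vP3_gens vP3_rels [(p, True)]"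

interpretation V: group vP3
  unfolding vP3_def by (rule group_presented_group)

lemma xgen_carrier: "p \<in> vP3_gens \<Longrightarrow> xgen p \<in> carrier vP3"
  unfolding xgen_def vP3_def by (rule presented_group_class_carrier) simp

lemma xgen_rel:
  assumes "(pos [a, b, c], pos [d, e, f]) \<in> vP3_rels" "{a, b, c, d, e, f} \<subseteq> vP3_gens"
  shows "xgen a \<otimes>\<^bsub>vP3\<^esub> (xgen b \<otimes>\<^bsub>vP3\<^esub> xgen c) = xgen d \<otimes>\<^bsub>vP3\<^esub> (xgen e \<otimes>\<^bsub>vP3\<^esub> xgen f)"
proof -
  have cls: "xgen a \<otimes>\<^bsub>vP3\<^esub> (xgen b \<otimes>\<^bsub>vP3\<^esub> xgen c) = word_class vP3_gens vP3_rels (pos [a, b, c])"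
    if "{a, b, c} \<subseteq> vP3_gens" for a b c
    using that unfolding xgen_def vP3_def
    by (simp add: presented_group_mult pos_def)
  have "([] @ pos [a, b, c] @ [], [] @ pos [d, e, f] @ []) \<in> pres_cong vP3_gens vP3_rels"
    by (rule pres_cong.rel[OF _ _ _ _ assms(1)]) (use assms(2) in simp_all)
  then have "word_class vP3_gens vP3_rels (pos [a, b, c]) = word_class vP3_gens vP3_rels (pos [d, e, f])"
    by (intro equiv_class_eq[OF equiv_pres_cong]) simp
  then show ?thesis using cls assms(2) by simp
qed

text \<open>Together with \<open>m_assoc\<close> these rules let the simplifier cancel inside
  products nested to the right.\<close>

lemma (in group) cancel_left [simp]:
  "x \<in> carrier G \<Longrightarrow> y \<in> carrier G \<Longrightarrow> x \<otimes> (inv x \<otimes> y) = y"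
  "x \<in> carrier G \<Longrightarrow> y \<in> carrier G \<Longrightarrow> inv x \<otimes> (x \<otimes> y) = y"
  by (simp_all add: m_assoc[symmetric])

text \<open>Here \<open>a\<close>, ..., \<open>e\<close> are the elements \<open>Y\<^sub>1\<close>,
  ..., \<open>Y\<^sub>5\<close>, and the six equations are the cyclic relations with
  \<open>Y\<^sub>0 = 1\<close>.\<close>

lemma vP3_hom_of_twisted:
  assumes "group X" "t \<in> carrier X" "{a, b, c, d, e} \<subseteq> carrier X"
    and "a \<otimes>\<^bsub>X\<^esub> b = b \<otimes>\<^bsub>X\<^esub> a" "a \<otimes>\<^bsub>X\<^esub> (b \<otimes>\<^bsub>X\<^esub> c) = c \<otimes>\<^bsub>X\<^esub> (b \<otimes>\<^bsub>X\<^esub> a)"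
      "b \<otimes>\<^bsub>X\<^esub> (c \<otimes>\<^bsub>X\<^esub> d) = d \<otimes>\<^bsub>X\<^esub> (c \<otimes>\<^bsub>X\<^esub> b)" "c \<otimes>\<^bsub>X\<^esub> (d \<otimes>\<^bsub>X\<^esub> e) = e \<otimes>\<^bsub>X\<^esub> (d \<otimes>\<^bsub>X\<^esub> c)"
      "d \<otimes>\<^bsub>X\<^esub> e = e \<otimes>\<^bsub>X\<^esub> d" "e \<otimes>\<^bsub>X\<^esub> a = a \<otimes>\<^bsub>X\<^esub> e"
  obtains h where "h \<in> hom vP3 X" "h (xgen (1, 2)) = t"
    "h (xgen (1, 3)) = inv\<^bsub>X\<^esub> t \<otimes>\<^bsub>X\<^esub> a" "h (xgen (2, 3)) = b \<otimes>\<^bsub>X\<^esub> t"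
    "h (xgen (2, 1)) = inv\<^bsub>X\<^esub> t \<otimes>\<^bsub>X\<^esub> c" "h (xgen (3, 1)) = d \<otimes>\<^bsub>X\<^esub> t"
    "h (xgen (3, 2)) = inv\<^bsub>X\<^esub> t \<otimes>\<^bsub>X\<^esub> e"
proof -
  interpret group X by fact
  let ?m = "\<lambda>x y. x \<otimes>\<^bsub>X\<^esub> y"
  define f where "f p =
    (if p = (1, 2) then t else if p = (1, 3) then inv\<^bsub>X\<^esub> t \<otimes>\<^bsub>X\<^esub> a
     else if p = (2, 3) then b \<otimes>\<^bsub>X\<^esub> t else if p = (2, 1) then inv\<^bsub>X\<^esub> t \<otimes>\<^bsub>X\<^esub> c
     else if p = (3, 1) then d \<otimes>\<^bsub>X\<^esub> t else inv\<^bsub>X\<^esub> t \<otimes>\<^bsub>X\<^esub> e)" for p :: "nat \<times> nat"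
  note carr = assms(2) assms(3)[simplified]
  have cl: "f \<in> vP3_gens \<rightarrow> carrier X"
    using carr by (auto simp: f_def)
  \<comment> \<open>A relation starting at an even index leaves a factor \<open>t\<close> at the
    right end. After nesting to the right, its equation is applied in front of that factor.\<close>
  have tail: "?m x (?m y w) = ?m y (?m x w)" if "?m x y = ?m y x" "x \<in> carrier X" "y \<in> carrier X" "w \<in> carrier X" for x y w
    using that by (simp add: m_assoc[symmetric])
  have tail3: "?m x (?m y (?m z w)) = ?m z (?m y (?m x w))"
    if "?m x (?m y z) = ?m z (?m y x)" "x \<in> carrier X" "y \<in> carrier X" "z \<in> carrier X" "w \<in> carrier X"
    for x y z w
  proof -
    have "?m x (?m y (?m z w)) = ?m (?m x (?m y z)) w" using that(2-) by (simp add: m_assoc)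
    also have "\<dots> = ?m z (?m y (?m x w))" unfolding that(1) using that(2-) by (simp add: m_assoc)
    finally show ?thesis .
  qed
  have "word_eval X f u = word_eval X f v" if "(u, v) \<in> vP3_rels" for u v
    using that carr tail[OF assms(4), of t] assms(5,7,9) tail3[OF assms(6), of t] tail[OF assms(8), of t]
    unfolding vP3_rels_eq by (auto simp: pos_def f_def m_assoc)
  then have "\<exists>h \<in> hom (presented_group vP3_gens vP3_rels) X.
      \<forall>x \<in> vP3_gens. h (word_class vP3_gens vP3_rels [(x, True)]) = f x"
    by (intro presented_group_lift[OF assms(1) cl])
  then obtain h
    where "h \<in> hom vP3 X" "\<And>p. p \<in> vP3_gens \<Longrightarrow> h (xgen p) = f p"
    unfolding vP3_def xgen_def by blast
  then show ?thesis
    by (intro that[of h]) (simp_all add: vP3_gens_eq f_def)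
qed

text \<open>The cyclic relations imply the conjugation relations of the semidirect product for the
  elements assigned to \<open>S\<close>, \<open>U\<close>, \<open>T\<close>, \<open>Q\<close> and
  \<open>R\<close>; \<open>Z\<close> is sent to the identity.\<close>

lemma qgroup_hom_of_hexagon:
  assumes "group X" "{a, b, c, d, e} \<subseteq> carrier X"
    and comm: "a \<otimes>\<^bsub>X\<^esub> b = b \<otimes>\<^bsub>X\<^esub> a" "a \<otimes>\<^bsub>X\<^esub> (b \<otimes>\<^bsub>X\<^esub> c) = c \<otimes>\<^bsub>X\<^esub> (b \<otimes>\<^bsub>X\<^esub> a)"
      "b \<otimes>\<^bsub>X\<^esub> (c \<otimes>\<^bsub>X\<^esub> d) = d \<otimes>\<^bsub>X\<^esub> (c \<otimes>\<^bsub>X\<^esub> b)" "c \<otimes>\<^bsub>X\<^esub> (d \<otimes>\<^bsub>X\<^esub> e) = e \<otimes>\<^bsub>X\<^esub> (d \<otimes>\<^bsub>X\<^esub> c)"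
      "d \<otimes>\<^bsub>X\<^esub> e = e \<otimes>\<^bsub>X\<^esub> d" "e \<otimes>\<^bsub>X\<^esub> a = a \<otimes>\<^bsub>X\<^esub> e"
  obtains h where "h \<in> hom qgroup X" "h (qclass [(S, True)]) = a"
    "h (qclass [(U, True)]) = a \<otimes>\<^bsub>X\<^esub> b" "h (qclass [(T, True)]) = c"
    "h (qclass [(Q, True)]) = c \<otimes>\<^bsub>X\<^esub> d" "h (qclass [(R, True)]) = e"
    "h (qclass [(Z, True)]) = \<one>\<^bsub>X\<^esub>"
proof -
  interpret group X by fact
  note [simp] = assms(2)[simplified]
  let ?m = "\<lambda>x y. x \<otimes>\<^bsub>X\<^esub> y"
  define u where "u = ?m a b"
  define q where "q = ?m c d"
  define w where "w = ?m d c"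
  have [simp]: "u \<in> carrier X" "q \<in> carrier X" "w \<in> carrier X" by (simp_all add: u_def q_def w_def)
  have "?m a u = ?m a (?m b a)" by (simp only: u_def comm(1))
  also have "\<dots> = ?m u a" by (simp add: u_def m_assoc)
  finally have au: "?m a u = ?m u a" .
  have "?m c u = ?m c (?m b a)" by (simp only: u_def comm(1))
  also have "\<dots> = ?m u c" unfolding comm(2)[symmetric] by (simp add: u_def m_assoc)
  finally have cu: "?m c u = ?m u c" .
  \<comment> \<open>The element \<open>w\<close> equals \<open>q\<close> conjugated by the inverse
    of the product \<open>q e\<close>. Since \<open>c\<close> conjugates \<open>w\<close> to
    \<open>q\<close> and commutes with \<open>q e\<close>, it conjugates both \<open>q\<close> and
    \<open>e\<close> by \<open>q e\<close>.\<close>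
  have qe: "?m q e = ?m e w" using comm(4) by (simp add: q_def w_def m_assoc)
  have w: "w = ?m (inv\<^bsub>X\<^esub> e) (?m q e)" unfolding qe by simp
  have "?m q e = ?m (?m e d) c" by (simp add: qe w_def m_assoc)
  then have "?m c (?m q e) = ?m c (?m (?m d e) c)" by (simp only: comm(5))
  also have "\<dots> = ?m (?m q e) c" by (simp add: q_def m_assoc)
  finally have cqe: "?m c (?m q e) = ?m (?m q e) c" .
  have "?m c w = ?m q c" by (simp add: q_def w_def m_assoc)
  then have "?m c (inv\<^bsub>X\<^esub> w) = ?m (inv\<^bsub>X\<^esub> q) c"
    by (intro intertwine_inv_right) simp_all
  then have ciw: "?m (inv\<^bsub>X\<^esub> q) c = ?m c (?m (inv\<^bsub>X\<^esub> e) (?m (inv\<^bsub>X\<^esub> q) e))"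
    by (simp add: w inv_mult_group m_assoc)
  have "?m q (?m e (?m (inv\<^bsub>X\<^esub> q) c)) = ?m (?m (?m q e) c) (?m (inv\<^bsub>X\<^esub> e) (?m (inv\<^bsub>X\<^esub> q) e))"
    unfolding ciw by (simp add: m_assoc)
  also have "\<dots> = ?m c e"
    unfolding cqe[symmetric] by (simp add: m_assoc)
  finally have ce: "?m c e = ?m (?m q (?m e (inv\<^bsub>X\<^esub> q))) c" by (simp add: m_assoc)
  have "?m c (inv\<^bsub>X\<^esub> e) = ?m (inv\<^bsub>X\<^esub> (?m q (?m e (inv\<^bsub>X\<^esub> q)))) c"
    using ce by (intro intertwine_inv_right) simp_all
  then have cie: "?m c (inv\<^bsub>X\<^esub> e) = ?m q (?m (inv\<^bsub>X\<^esub> e) (?m (inv\<^bsub>X\<^esub> q) c))"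
    by (simp add: inv_mult_group m_assoc)
  have "?m q (?m e (?m q (?m (inv\<^bsub>X\<^esub> e) (?m (inv\<^bsub>X\<^esub> q) c)))) = ?m (?m (?m q e) c) (inv\<^bsub>X\<^esub> e)"
    unfolding cie[symmetric] by (simp add: m_assoc)
  also have "\<dots> = ?m c q"
    unfolding cqe[symmetric] by (simp add: m_assoc)
  finally have cq: "?m c q = ?m q (?m e (?m q (?m (inv\<^bsub>X\<^esub> e) (?m (inv\<^bsub>X\<^esub> q) c))))" ..
  have ea: "?m (inv\<^bsub>X\<^esub> e) a = ?m a (inv\<^bsub>X\<^esub> e)"
    using comm(6) by (intro intertwine_inv_left) simp_all
  \<comment> \<open>The relation for \<open>S\<close> and \<open>Q\<close>: \<open>b\<close>
    conjugates \<open>q\<close> to \<open>w\<close>, which is \<open>q\<close> conjugated by the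
    inverse of \<open>e\<close>. As \<open>e\<close> commutes with \<open>a\<close> and
    \<open>u\<close> is the product of \<open>a\<close> and \<open>b\<close>, it follows that
    \<open>a\<close> conjugates \<open>q\<close> by \<open>e u\<close>.\<close>
  have bq: "?m b q = ?m w b" using comm(3) by (simp add: q_def w_def m_assoc)
  have "?m u q = ?m a (?m b q)" by (simp add: u_def m_assoc)
  also have "\<dots> = ?m (?m a (inv\<^bsub>X\<^esub> e)) (?m q (?m e b))"
    unfolding bq by (simp add: w m_assoc)
  also have "\<dots> = ?m (?m (inv\<^bsub>X\<^esub> e) a) (?m q (?m e b))"
    unfolding ea ..
  finally have euq: "?m e (?m u q) = ?m a (?m q (?m e b))" by (simp add: m_assoc)
  have biu: "?m b (inv\<^bsub>X\<^esub> u) = inv\<^bsub>X\<^esub> a" by (simp add: u_def inv_mult_group)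
  have "?m e (?m u (?m q (?m (inv\<^bsub>X\<^esub> u) (?m (inv\<^bsub>X\<^esub> e) a))))
      = ?m (?m e (?m u q)) (?m (inv\<^bsub>X\<^esub> u) (?m (inv\<^bsub>X\<^esub> e) a))"
    by (simp add: m_assoc)
  also have "\<dots> = ?m (?m a (?m q e)) (?m (?m b (inv\<^bsub>X\<^esub> u)) (?m (inv\<^bsub>X\<^esub> e) a))"
    unfolding euq by (simp add: m_assoc)
  also have "\<dots> = ?m a q"
    unfolding biu ea by (simp add: m_assoc)
  finally have aq: "?m a q = ?m e (?m u (?m q (?m (inv\<^bsub>X\<^esub> u) (?m (inv\<^bsub>X\<^esub> e) a))))" ..
  define f where "f = (\<lambda>g. case g of S \<Rightarrow> a | T \<Rightarrow> c | U \<Rightarrow> u | Q \<Rightarrow> q | R \<Rightarrow> e | Z \<Rightarrow> \<one>\<^bsub>X\<^esub>)"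
  have cl: "f \<in> UNIV \<rightarrow> carrier X"
    by (auto simp: f_def split: qgen.split)
  have rel: "word_eval X f [(h, True), (n, True)] = word_eval X f (conj_fib (h, True) n @ [(h, True)])"
    if hn: "h \<in> base" "n \<in> fib" for h n
  proof -
    consider "h = S" "n = U" | "h = S" "n = Q" | "h = S" "n = R"
      | "h = T" "n = U" | "h = T" "n = Q" | "h = T" "n = R"
      using hn by blast
    then show ?thesis
    proof cases
      case 1
      then show ?thesis by (simp add: f_def au)
    next
      case 2
      then show ?thesis by (simp add: f_def aq)
    next
      case 3
      then show ?thesis by (simp add: f_def comm(6))
    next
      case 4
      then show ?thesis by (simp add: f_def cu)
    next
      case 5
      then show ?thesis by (simp add: f_def cq)
    next
      case 6
      then show ?thesis by (simp add: f_def ce m_assoc)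
    qed
  qed
  have "word_eval X f v = word_eval X f v'" if vv': "(v, v') \<in> qrels" for v v'
  proof -
    consider "v = [(Z, True)]" "v' = []"
      | h n where "h \<in> base" "n \<in> fib" "v = [(h, True), (n, True)]"
          "v' = conj_fib (h, True) n @ [(h, True)]"
      using vv' unfolding qrels_def by blast
    then show ?thesis
    proof cases
      case 1
      then show ?thesis by (simp add: f_def)
    next
      case 2
      then show ?thesis by (simp only: rel)
    qed
  qed
  then have "\<exists>h \<in> hom (presented_group UNIV qrels) X.
      \<forall>x \<in> UNIV. h (word_class UNIV qrels [(x, True)]) = f x"
    by (intro presented_group_lift[OF assms(1) cl])
  then
  obtain h where "h \<in> hom (presented_group UNIV qrels) X"
    and h: "\<forall>g \<in> UNIV. h (qclass [(g, True)]) = f g"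
    by (elim bexE)
  then have "h \<in> hom qgroup X" by (simp only: qgroup_def)
  then show ?thesis
    by (rule that) (simp_all add: h f_def u_def q_def)
qed

text \<open>Conversely, solving for the \<open>Y\<^sub>i\<close> in the generators of
  \<open>qgroup\<close> gives elements that satisfy the cyclic relations.\<close>

lemma qgroup_hexagon_check:
  "let a = [(S, True)]; b = [(S, False), (U, True)]; c = [(T, True)]; d = [(T, False), (Q, True)];
     e = [(R, True)] in
     nf (a @ b) = nf (b @ a) \<and> nf (a @ b @ c) = nf (c @ b @ a) \<and> nf (b @ c @ d) = nf (d @ c @ b) \<and>
     nf (c @ d @ e) = nf (e @ d @ c) \<and> nf (d @ e) = nf (e @ d) \<and> nf (e @ a) = nf (a @ e)"
  by code_simp

theorem lemma2p4:
  shows "vP3 \<cong> free_product (pure_braid_group_mod_center 4) integer_group"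
proof -
  let ?P = "pure_braid_group_mod_center 4"
  let ?M = "free_product ?P integer_group"
  interpret C: normal "center (pure_braid_group 4)" "pure_braid_group 4" by (rule P.center_normal)
  interpret PC: group ?P
    unfolding pure_braid_group_mod_center_def by (rule C.factorgroup_is_group)
  interpret M: group ?M by (rule group_free_product)
  obtain \<kappa> where \<kappa>: "\<kappa> \<in> iso ?P qgroup"
    using pure_braid_group_mod_center_iso unfolding is_iso_def by blast
  define \<kappa>' where "\<kappa>' = inv_into (carrier ?P) \<kappa>"
  have \<kappa>': "\<kappa>' \<in> iso qgroup ?P" unfolding \<kappa>'_def by (rule PC.iso_set_sym[OF \<kappa>])
  have \<kappa>'\<kappa>: "\<kappa>' (\<kappa> g) = g" if "g \<in> carrier ?P" for g
    using \<kappa> that by (auto simp: \<kappa>'_def iso_def bij_betw_def)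
  let ?l = "\<lambda>g. free_gen ?P integer_group (Inl g)" and ?r = "\<lambda>n. free_gen ?P integer_group (Inr n)"
  have l: "?l \<in> hom ?P ?M" by (rule free_gen_Inl_hom[OF PC.is_group])
  have r: "?r \<in> hom integer_group ?M" by (rule free_gen_Inr_hom[OF group_integer_group])
  \<comment> \<open>The inclusion of the first factor, read on the concrete model
    \<open>qgroup\<close>.\<close>
  define k where "k = ?l \<circ> \<kappa>'"
  have k: "k \<in> hom qgroup ?M"
    unfolding k_def using \<kappa>' l by (intro hom_compose[of _ _ ?P]) (auto simp: iso_def)
  interpret k: group_hom qgroup ?M k
    by (intro group_hom.intro group_hom_axioms.intro k Q.is_group M.is_group)
  define t where "t = ?r 1"
  have t: "t \<in> carrier ?M" unfolding t_def by (intro free_gen_carrier) auto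
  let ?q = "\<lambda>w. k (qclass w)"
  have q: "?q (u @ v) = ?q u \<otimes>\<^bsub>?M\<^esub> ?q v" for u v
    by (simp add: qclass_append)
  have qn: "?q u = ?q v" if "nf u = nf v" for u v
    using nf_eq_imp[OF that] by simp
  let ?a = "[(S, True)]" and ?b = "[(S, False), (U, True)]" and ?c = "[(T, True)]"
    and ?d = "[(T, False), (Q, True)]" and ?e = "[(R, True)]"
  have rels: "?q (?a @ ?b) = ?q (?b @ ?a)" "?q (?a @ ?b @ ?c) = ?q (?c @ ?b @ ?a)"
    "?q (?b @ ?c @ ?d) = ?q (?d @ ?c @ ?b)" "?q (?c @ ?d @ ?e) = ?q (?e @ ?d @ ?c)"
    "?q (?d @ ?e) = ?q (?e @ ?d)" "?q (?e @ ?a) = ?q (?a @ ?e)"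
    using qgroup_hexagon_check unfolding Let_def by - (rule qn, elim conjE, assumption)+
  define y0 y1 y2 y3 y4 y5 where y_def: "y0 = xgen (1, 2)" "y1 = xgen (1, 3)"
    "y2 = xgen (2, 3)" "y3 = xgen (2, 1)" "y4 = xgen (3, 1)" "y5 = xgen (3, 2)"
  obtain \<alpha> where \<alpha>: "\<alpha> \<in> hom vP3 ?M" "\<alpha> y0 = t"
    "\<alpha> y1 = inv\<^bsub>?M\<^esub> t \<otimes>\<^bsub>?M\<^esub> ?q ?a" "\<alpha> y2 = ?q ?b \<otimes>\<^bsub>?M\<^esub> t"
    "\<alpha> y3 = inv\<^bsub>?M\<^esub> t \<otimes>\<^bsub>?M\<^esub> ?q ?c" "\<alpha> y4 = ?q ?d \<otimes>\<^bsub>?M\<^esub> t"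
    "\<alpha> y5 = inv\<^bsub>?M\<^esub> t \<otimes>\<^bsub>?M\<^esub> ?q ?e"
    by (rule vP3_hom_of_twisted[OF M.is_group t, of "?q ?a" "?q ?b" "?q ?c" "?q ?d" "?q ?e"])
      (use rels in \<open>simp_all only: q y_def, simp_all\<close>)
  interpret \<alpha>: group_hom vP3 ?M \<alpha>
    by (intro group_hom.intro group_hom_axioms.intro \<alpha>(1) V.is_group M.is_group)
  have xc [simp]: "y0 \<in> carrier vP3" "y1 \<in> carrier vP3" "y2 \<in> carrier vP3"
    "y3 \<in> carrier vP3" "y4 \<in> carrier vP3" "y5 \<in> carrier vP3"
    unfolding y_def by (intro xgen_carrier; simp add: vP3_gens_eq)+
  let ?v = "\<lambda>x y. x \<otimes>\<^bsub>vP3\<^esub> y"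
  have xr: "?v (xgen a) (?v (xgen b) (xgen c)) = ?v (xgen c) (?v (xgen b) (xgen a))"
    if "(pos [a, b, c], pos [c, b, a]) \<in> vP3_rels" "{a, b, c} \<subseteq> vP3_gens" for a b c
    using that by (intro xgen_rel) auto
  have X: "?v y0 (?v y1 y2) = ?v y2 (?v y1 y0)"
    "?v y1 (?v y0 y5) = ?v y5 (?v y0 y1)"
    "?v y3 (?v y2 y1) = ?v y1 (?v y2 y3)"
    "?v y2 (?v y3 y4) = ?v y4 (?v y3 y2)"
    "?v y4 (?v y5 y0) = ?v y0 (?v y5 y4)"
    "?v y5 (?v y4 y3) = ?v y3 (?v y4 y5)"
    unfolding y_def by (intro xr; simp add: vP3_rels_eq vP3_gens_eq)+
  \<comment> \<open>The relations starting at \<open>y2\<close>, \<open>y0\<close> and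
    \<open>y4\<close>, multiplied on the right by the inverse of \<open>y0\<close>, which removes
    the trailing \<open>t\<close>.\<close>
  have X': "?v y2 (?v y3 (?v y4 (inv\<^bsub>vP3\<^esub> y0)))
      = ?v y4 (?v y3 (?v y2 (inv\<^bsub>vP3\<^esub> y0)))"
    using arg_cong[OF X(4), of "\<lambda>z. ?v z (inv\<^bsub>vP3\<^esub> y0)"] by (simp add: V.m_assoc)
  have X1: "?v y0 (?v y1 (?v y2 (inv\<^bsub>vP3\<^esub> y0))) = ?v y2 y1"
    using arg_cong[OF X(1), of "\<lambda>z. ?v z (inv\<^bsub>vP3\<^esub> y0)"] by (simp add: V.m_assoc)
  have X5: "?v y0 (?v y5 (?v y4 (inv\<^bsub>vP3\<^esub> y0))) = ?v y4 y5"
    using arg_cong[OF X(5), of "\<lambda>z. ?v z (inv\<^bsub>vP3\<^esub> y0)"] by (simp add: V.m_assoc)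
  \<comment> \<open>The substitution for \<open>\<alpha>\<close> solved backwards:
    \<open>Y\<^sub>i\<close> is \<open>y0\<close> times the odd generators, and the even generators
    times the inverse of \<open>y0\<close>.\<close>
  obtain \<beta>0 where \<beta>0: "\<beta>0 \<in> hom qgroup vP3" "\<beta>0 (qclass [(S, True)]) = ?v y0 y1"
    "\<beta>0 (qclass [(U, True)]) = ?v (?v y0 y1) (?v y2 (inv\<^bsub>vP3\<^esub> y0))"
    "\<beta>0 (qclass [(T, True)]) = ?v y0 y3"
    "\<beta>0 (qclass [(Q, True)]) = ?v (?v y0 y3) (?v y4 (inv\<^bsub>vP3\<^esub> y0))"
    "\<beta>0 (qclass [(R, True)]) = ?v y0 y5" "\<beta>0 (qclass [(Z, True)]) = \<one>\<^bsub>vP3\<^esub>"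
    by (rule qgroup_hom_of_hexagon[OF V.is_group, of "?v y0 y1"
          "?v y2 (inv\<^bsub>vP3\<^esub> y0)" "?v y0 y3" "?v y4 (inv\<^bsub>vP3\<^esub> y0)"
          "?v y0 y5"])
      (use X X' X1 X5 in \<open>simp_all add: V.m_assoc\<close>)
  interpret \<beta>0: group_hom qgroup vP3 \<beta>0
    by (intro group_hom.intro group_hom_axioms.intro \<beta>0(1) V.is_group Q.is_group)
  have "\<beta>0 \<circ> \<kappa> \<in> hom ?P vP3"
    using \<kappa> \<beta>0(1) by (intro hom_compose[of _ _ qgroup]) (auto simp: iso_def)
  from free_product_lift[OF V.is_group this V.hom_integer_group_pow[OF xc(1)]]
  obtain \<beta> where \<beta>: "\<beta> \<in> hom ?M vP3" "\<And>g. g \<in> carrier ?P \<Longrightarrow> \<beta> (?l g) = \<beta>0 (\<kappa> g)"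
    "\<And>n. \<beta> (?r n) = y0 [^]\<^bsub>vP3\<^esub> (n :: int)"
    by (auto simp: comp_def)
  interpret \<beta>: group_hom ?M vP3 \<beta>
    by (intro group_hom.intro group_hom_axioms.intro \<beta>(1) V.is_group M.is_group)
  have \<beta>t: "\<beta> t = y0" unfolding t_def \<beta>(3) by simp
  have \<kappa>\<kappa>': "\<kappa> (\<kappa>' x) = x" "\<kappa>' x \<in> carrier ?P" if "x \<in> carrier qgroup" for x
    using \<kappa> \<kappa>' that by (auto simp: \<kappa>'_def iso_def bij_betw_def f_inv_into_f inv_into_into)
  have \<beta>k: "\<beta> (k x) = \<beta>0 x" if "x \<in> carrier qgroup" for x
    using \<kappa>\<kappa>'[OF that] by (simp add: k_def \<beta>(2))
  have sf: "qclass [(g, False), (g', True)] = inv\<^bsub>qgroup\<^esub> qclass [(g, True)] \<otimes>\<^bsub>qgroup\<^esub> qclass [(g', True)]" for g g'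
    by (simp add: qclass_append[symmetric] qclass_inv[symmetric])
  have \<beta>\<alpha>: "\<beta> (\<alpha> x) = x" if "x \<in> carrier vP3" for x
  proof -
    have "(\<beta> \<circ> \<alpha>) x = id x"
    proof (rule presented_group_hom_eqI[OF V.is_group, of "\<beta> \<circ> \<alpha>" vP3_gens vP3_rels])
      show "\<beta> \<circ> \<alpha> \<in> hom (presented_group vP3_gens vP3_rels) vP3"
        unfolding vP3_def[symmetric] by (rule hom_compose[OF \<alpha>(1) \<beta>(1)])
      show "id \<in> hom (presented_group vP3_gens vP3_rels) vP3"
        unfolding vP3_def[symmetric] by (auto simp: hom_def)
      show "x \<in> carrier (presented_group vP3_gens vP3_rels)"
        using that by (simp add: vP3_def)
      have "\<beta> (\<alpha> y0) = y0" "\<beta> (\<alpha> y1) = y1" "\<beta> (\<alpha> y2) = y2" "\<beta> (\<alpha> y3) = y3"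
        "\<beta> (\<alpha> y4) = y4" "\<beta> (\<alpha> y5) = y5"
        using t by (simp_all add: \<alpha> \<beta>t \<beta>k \<beta>0 sf V.m_assoc V.inv_mult_group)
      moreover fix p assume "p \<in> vP3_gens"
      ultimately have "\<beta> (\<alpha> (xgen p)) = xgen p"
        unfolding vP3_gens_eq y_def by auto
      then show "(\<beta> \<circ> \<alpha>) (word_class vP3_gens vP3_rels [(p, True)])
          = id (word_class vP3_gens vP3_rels [(p, True)])"
        by (simp add: xgen_def)
    qed
    then show ?thesis by simp
  qed
  \<comment> \<open>The generators of the free product are all elements of its factors. The
    comparison on the first factor is therefore made on the six generators of \<open>qgroup\<close>
    and extended to all its elements.\<close>
  have \<alpha>\<beta>0: "\<alpha> (\<beta>0 x) = k x" if "x \<in> carrier qgroup" for x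
  proof -
    have "(\<alpha> \<circ> \<beta>0) x = k x"
    proof (rule presented_group_hom_eqI[OF M.is_group, of "\<alpha> \<circ> \<beta>0" UNIV qrels])
      show "\<alpha> \<circ> \<beta>0 \<in> hom (presented_group UNIV qrels) ?M"
        unfolding qgroup_def[symmetric] by (rule hom_compose[OF \<beta>0(1) \<alpha>(1)])
      show "k \<in> hom (presented_group UNIV qrels) ?M"
        unfolding qgroup_def[symmetric] by (rule k)
      show "x \<in> carrier (presented_group UNIV qrels)" using that by (simp add: qgroup_def)
      fix g
      show "(\<alpha> \<circ> \<beta>0) (qclass [(g, True)]) = k (qclass [(g, True)])"
        using t by (cases g) (simp_all add: \<alpha> \<beta>0 sf M.m_assoc qclass_Z)
    qed
    then show ?thesis by simp
  qed
  have \<alpha>\<beta>: "\<alpha> (\<beta> x) = x" if "x \<in> carrier ?M" for x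
  proof -
    have "(\<alpha> \<circ> \<beta>) x = id x"
    proof (rule free_product_hom_eqI[OF M.is_group hom_compose[OF \<beta>(1) \<alpha>(1)] _ _ _ that])
      show "id \<in> hom ?M ?M" by (auto simp: hom_def)
      fix g assume g: "g \<in> carrier ?P"
      have "\<kappa> g \<in> carrier qgroup" using \<kappa> g by (auto simp: iso_def hom_def)
      then show "(\<alpha> \<circ> \<beta>) (?l g) = id (?l g)"
        using g by (simp add: \<beta>(2) \<alpha>\<beta>0 k_def \<kappa>'\<kappa>)
    next
      fix n :: int
      \<comment> \<open>The infinite cyclic factor is generated by 1, so the equation for
        \<open>t\<close> determines all its elements.\<close>
      have "?r n = ?r (1 [^]\<^bsub>integer_group\<^esub> n)" by simp
      also have "\<dots> = t [^]\<^bsub>?M\<^esub> n"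
        unfolding t_def by (rule hom_int_pow[OF r]) simp_all
      finally have rn: "?r n = t [^]\<^bsub>?M\<^esub> n" .
      have "\<alpha> (\<beta> (?r n)) = t [^]\<^bsub>?M\<^esub> n"
        by (simp only: \<beta>(3) \<alpha>.hom_int_pow[OF xc(1)] \<alpha>(2))
      then show "(\<alpha> \<circ> \<beta>) (?r n) = id (?r n)"
        by (simp only: comp_apply id_apply rn)
    qed
    then show ?thesis by simp
  qed
  have "bij_betw \<alpha> (carrier vP3) (carrier ?M)"
    by (rule bij_betw_byWitness[of _ \<beta>]) (auto simp: \<alpha>\<beta> \<beta>\<alpha>)
  then have "\<alpha> \<in> iso vP3 ?M"
    using \<alpha>(1) by (simp add: iso_def)
  then show ?thesis by (rule is_isoI)
qed

end
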